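(* Let $(\mathbb{R}^4,\omega)$ be a symplectic vector space, with $\omega$ viewed as a map $\omega:\mathbb{R}^4\to\mathbb{R}^{4*}$, $\mathbf v\mapsto\omega(\mathbf v,\cdot)$. Let $\Sigma=\{\mathbf v:(S\mathbf v,\mathbf v)=0\}\subset\mathbb{RP}^3$ be a non-degenerate quadratic surface, where $S:\mathbb{R}^4\to\mathbb{R}^{4*}$ is symmetric and invertible, with generator $X=\omega^{-1}S\in\mathfrak{sp}_4(\mathbb{R})$. Then the polar surface of $\Sigma$ with respect to $\omega$ is the quadratic surface $\Sigma'=\{\mathbf v:(S'\mathbf v,\mathbf v)=0\}\subset\mathbb{RP}^3$ with $X^*S'X=S$, i.e. $S'=-\omega S^{-1}\omega$. The domain of the outer contact billiard map over $\Sigma$ (or $\Sigma'$) is the region foliated by the quadrics $$I_{\sigma^2}=\{\mathbf v:(S\mathbf v,\mathbf v)=-\sigma^2\det X\,(S'\mathbf v,\mathbf v)\},\qquad\sigma\in(0,\infty),$$ from the pencil of quadrics through $\Sigma,\Sigma'$. Each quadric $I_{\sigma^2}$ is invariant under the outer contact billiard map over $\Sigma$ (or $\Sigma'$), which is given explicitly by iterating $$I_{\sigma^2}\ni\mathrm{span}\{\mathbf Z\}\mapsto\mathrm{span}\{(\mathrm{id}-\sigma X)(\mathrm{id}+\sigma X)^{-1}\mathbf Z\}\in I_{\sigma^2}$$ as long as $1/\sigma$ is not an eigenvalue of $X$.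
   Context: $(\nu,\mathbf v)$ denotes the natural pairing of $\nu\in\mathbb{R}^{4*}$ and $\mathbf v\in\mathbb{R}^4$. $\mathbb{RP}^3$ is the space of lines through the origin in $\mathbb{R}^4$, with contact structure $\xi_q=q^\omega$ ($W^\omega$ is the $\omega$-orthogonal complement of $W$). For a hypersurface $\Sigma$ and $q\in\Sigma$, put $q'=(T_q\Sigma)^\omega$, with $T_q\Sigma$ the projective tangent plane viewed as a hyperplane of $\mathbb{R}^4$; the polar surface of $\Sigma$ is $\Sigma'=\{(T_q\Sigma)^\omega:q\in\Sigma\}$. When $q'\neq q$ the characteristic line at $q$ is the projective line through $q,q'$. Points $Z,Z'$ are in outer contact billiard correspondence over $\Sigma$ if there is $q\in\Sigma$ (with $q'\ne q$) such that $Z,Z'$ lie on the characteristic line at $q$ and are harmonic conjugates with respect to $q,q'$, i.e. there are lifts with $\mathbf Z=\mathbf q+\mathbf q'$, $\mathbf Z'=\mathbf q-\mathbf q'$. The outer contact billiard map sends a point to one of its two correspondents (the other correspondent being its image under the inverse map); its domain is the set of points on which it is defined.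
   Formalization: The domain, read as the points with exactly two correspondents, is the union of the I_{σ²} with 1/σ not an eigenvalue of X, minus Σ∩Σ'; on the excluded points the map is not defined. The explicit formula gives a correspondent except at eigenlines of X, where q'=q. *)

theory Defs
  imports "HOL-Analysis.Analysis"
begin

type_synonym V = "real^4"
type_synonym V_dual = "(real^4) \<Rightarrow>\<^sub>L real"

text \<open>
  Forms on \<open>V\<close> are linear maps \<open>V \<Rightarrow> V_dual\<close>, so that the pairing of \<open>\<nu>\<close> with \<open>v\<close> is
  \<open>blinfun_apply \<nu> v\<close>, inserted as a coercion.
\<close>

definition symplectic_form :: "(V \<Rightarrow> V_dual) \<Rightarrow> bool" where
  "symplectic_form \<omega> \<longleftrightarrow> linear \<omega> \<and> (\<forall>v. \<omega> v v = 0) \<and> bij \<omega>"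

definition symmetric_form :: "(V \<Rightarrow> V_dual) \<Rightarrow> bool" where
  "symmetric_form S \<longleftrightarrow> linear S \<and> (\<forall>u v. S u v = S v u)"

definition symplectic_algebra :: "(V \<Rightarrow> V_dual) \<Rightarrow> (V \<Rightarrow> V) set" where
  "symplectic_algebra \<omega> = {X. linear X \<and> (\<forall>u v. \<omega> (X u) v + \<omega> u (X v) = 0)}"

definition symplectic_complement :: "(V \<Rightarrow> V_dual) \<Rightarrow> V set \<Rightarrow> V set" where
  "symplectic_complement \<omega> W = {v. \<forall>w\<in>W. \<omega> v w = 0}"

text \<open>The transpose; it is meaningful only for linear \<open>X\<close>, since \<open>Blinfun\<close> is.\<close>

definition dual_map :: "(V \<Rightarrow> V) \<Rightarrow> V_dual \<Rightarrow> V_dual" where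
  "dual_map X \<nu> = \<nu> o\<^sub>L Blinfun X"

definition is_eigenvalue :: "(V \<Rightarrow> V) \<Rightarrow> real \<Rightarrow> bool" where
  "is_eigenvalue X c \<longleftrightarrow> (\<exists>v. v \<noteq> 0 \<and> X v = c *\<^sub>R v)"

definition RP3 :: "V set set" where
  "RP3 = {span {v} | v. v \<noteq> 0}"

definition quadric :: "(V \<Rightarrow> V_dual) \<Rightarrow> V set set" where
  "quadric S = {span {v} | v. v \<noteq> 0 \<and> S v v = 0}"

text \<open>
  For \<open>\<Sigma> \<subseteq> RP3\<close>, the tangent plane at \<open>q\<close>, as a subset of \<open>V\<close>, consists of the velocities of
  curves in the cone over \<open>\<Sigma>\<close> that start at a lift of \<open>q\<close>. The condition
  \<open>span {\<gamma> t} \<in> \<Sigma>\<close> forces \<open>\<gamma> t \<noteq> 0\<close>.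
\<close>

definition tangent_plane :: "V set set \<Rightarrow> V set \<Rightarrow> V set" where
  "tangent_plane \<Sigma> q = {w. \<exists>\<gamma> :: real \<Rightarrow> V.
     span {\<gamma> 0} = q \<and> (\<forall>\<^sub>F t in nhds 0. span {\<gamma> t} \<in> \<Sigma>) \<and>
     (\<gamma> has_vector_derivative w) (at 0)}"

definition polar_point :: "(V \<Rightarrow> V_dual) \<Rightarrow> V set set \<Rightarrow> V set \<Rightarrow> V set" where
  "polar_point \<omega> \<Sigma> q = symplectic_complement \<omega> (tangent_plane \<Sigma> q)"

definition polar_surface :: "(V \<Rightarrow> V_dual) \<Rightarrow> V set set \<Rightarrow> V set set" where
  "polar_surface \<omega> \<Sigma> = polar_point \<omega> \<Sigma> ` \<Sigma>"

text \<open>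
  \<open>Z\<close> and \<open>Z'\<close> are points of the characteristic line through \<open>q\<close> and \<open>q'\<close>, harmonic with
  respect to \<open>q\<close> and \<open>q'\<close>; \<open>u\<close> and \<open>u'\<close> are the lifts of \<open>q\<close> and \<open>q'\<close>.
\<close>

definition outer_correspondence ::
    "(V \<Rightarrow> V_dual) \<Rightarrow> V set set \<Rightarrow> V set \<Rightarrow> V set \<Rightarrow> bool" where
  "outer_correspondence \<omega> \<Sigma> Z Z' \<longleftrightarrow>
     (\<exists>q\<in>\<Sigma>. polar_point \<omega> \<Sigma> q \<noteq> q \<and>
       (\<exists>u u'. u \<noteq> 0 \<and> u' \<noteq> 0 \<and> q = span {u} \<and> polar_point \<omega> \<Sigma> q = span {u'} \<and>
          Z = span {u + u'} \<and> Z' = span {u - u'}))"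

definition correspondents :: "(V \<Rightarrow> V_dual) \<Rightarrow> V set set \<Rightarrow> V set \<Rightarrow> V set set" where
  "correspondents \<omega> \<Sigma> Z = {Z'. outer_correspondence \<omega> \<Sigma> Z Z'}"

text \<open>
  The map and its inverse send a point to its two correspondents. They are therefore defined
  at the points having exactly two, which excludes points with infinitely many
  (\<open>card\<close> is then 0).
\<close>

definition billiard_domain :: "(V \<Rightarrow> V_dual) \<Rightarrow> V set set \<Rightarrow> V set set" where
  "billiard_domain \<omega> \<Sigma> = {Z \<in> RP3. card (correspondents \<omega> \<Sigma> Z) = 2}"

text \<open>
  The correspondence does not single out one of the two correspondents, so being an outer
  contact billiard map is a predicate: each choice of branch that is consistent along orbits
  qualifies.
\<close>

definition outer_billiard_map ::
    "(V \<Rightarrow> V_dual) \<Rightarrow> V set set \<Rightarrow> (V set \<Rightarrow> V set) \<Rightarrow> bool" where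
  "outer_billiard_map \<omega> \<Sigma> T \<longleftrightarrow>
     bij_betw T (billiard_domain \<omega> \<Sigma>) (billiard_domain \<omega> \<Sigma>) \<and>
     (\<forall>Z \<in> billiard_domain \<omega> \<Sigma>.
        correspondents \<omega> \<Sigma> Z = {T Z, inv_into (billiard_domain \<omega> \<Sigma>) T Z})"

text \<open>\<open>(id - \<sigma> X) (id + \<sigma> X)\<^sup>-\<^sup>1\<close>; meaningful only if \<open>id + \<sigma> X\<close> is invertible.\<close>

definition cayley :: "(V \<Rightarrow> V) \<Rightarrow> real \<Rightarrow> V \<Rightarrow> V" where
  "cayley X \<sigma> = (\<lambda>v. v - \<sigma> *\<^sub>R X v) \<circ> inv (\<lambda>v. v + \<sigma> *\<^sub>R X v)"

end

theory Submission
  imports Defs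
begin

text \<open>
  Write \<open>X = \<omega>\<^sup>-\<^sup>1 S\<close>. Since \<open>T\<^sub>uS = ker \<omega>(X u, \<cdot>)\<close>, the polar point of \<open>span {u}\<close> is \<open>span {X u}\<close>,
  so \<open>Z\<close> and \<open>Z'\<close> correspond iff they have lifts \<open>u + a X u\<close> and \<open>u - a X u\<close> with \<open>S u u = 0\<close>;
  over the polar surface one obtains the same pairs. The characteristic polynomial of \<open>X\<close> is
  even, \<open>t\<^sup>4 + c t\<^sup>2 + d\<close> with \<open>d = det X\<close>; here \<open>t\<^sup>2 + c t + d\<close> is, up to a factor, the Pfaffian of
  \<open>\<omega> (t - X\<^sup>2)\<close>. Hence \<open>z = u + a X u\<close> satisfies
  \<open>S z z + a\<^sup>2 d S' z z = (1 + c a\<^sup>2 + d a\<^sup>4) S u u\<close>: the points with a correspondent lie on the pencil,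
  and conversely \<open>u = (id + a X)\<^sup>-\<^sup>1 z\<close> solves the problem whenever the factor on the right is nonzero,
  i.e. \<open>1 / a\<close> is not an eigenvalue. The remaining points are handled by exhibiting one-parameter
  families of correspondents as soon as there are two of them.
\<close>

section \<open>Pfaffians of skew matrices of size four\<close>

text \<open>The characteristic polynomial of \<open>X^2\<close> is the square of
  \<open>t^2 + c t + d\<close>; the Pfaffian supplies the quadratic factor itself and determines
  \<open>d\<close> rather than only its square. It is used twice: as a polynomial identity
  (\<open>cayley_hamilton\<close>), and through singular skew matrices, which turn a real root into
  an eigenvector of \<open>X^2\<close> (\<open>char_root_eigenvector\<close>). The obstacle is that
  the domain is defined by counting, so an exceptional point must be shown not to have exactly two
  correspondents. A base point that is not an eigenvector acquires one for every small
  \<open>a\<close>, because it lies on all members of the pencil. Off the base locus,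
  \<open>a\<close> is fixed up to sign. Two correspondents with the same \<open>a\<close> come from
  vectors \<open>u\<close> that differ by a kernel vector of \<open>id + a X\<close>, and
  \<open>u\<close> can be moved along it inside the quadric. For opposite signs and an exceptional
  \<open>a\<close>, comparing the two representations of \<open>z\<close> shows that a kernel vector
  is again such a direction.\<close>

lemma det_4: "det (A::real^4^4) =
    A$1$1 * (A$2$2 * (A$3$3 * A$4$4 - A$3$4 * A$4$3) - A$2$3 * (A$3$2 * A$4$4 - A$3$4 * A$4$2) + A$2$4 * (A$3$2 * A$4$3 - A$3$3 * A$4$2))
  - A$1$2 * (A$2$1 * (A$3$3 * A$4$4 - A$3$4 * A$4$3) - A$2$3 * (A$3$1 * A$4$4 - A$3$4 * A$4$1) + A$2$4 * (A$3$1 * A$4$3 - A$3$3 * A$4$1))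
  + A$1$3 * (A$2$1 * (A$3$2 * A$4$4 - A$3$4 * A$4$2) - A$2$2 * (A$3$1 * A$4$4 - A$3$4 * A$4$1) + A$2$4 * (A$3$1 * A$4$2 - A$3$2 * A$4$1))
  - A$1$4 * (A$2$1 * (A$3$2 * A$4$3 - A$3$3 * A$4$2) - A$2$2 * (A$3$1 * A$4$3 - A$3$3 * A$4$1) + A$2$3 * (A$3$1 * A$4$2 - A$3$2 * A$4$1))"
proof -
  have f: "finite {2::4, 3, 4}" "1 \<notin> {2::4, 3, 4}" "finite {3::4, 4}" "2 \<notin> {3::4, 4}" "finite {4::4}" "3 \<notin> {4::4}"
    by auto
  show ?thesis
    unfolding det_def UNIV_4
    unfolding sum_over_permutations_insert[OF f(1,2)]
    unfolding sum_over_permutations_insert[OF f(3,4)]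
    unfolding sum_over_permutations_insert[OF f(5,6)]
    unfolding permutes_sing
    by (simp add: sign_swap_id permutation_swap_id permutation_compose sign_compose swap_id_eq)
      (simp add: algebra_simps)
qed

lemma vector_4:
  "(vector [x,y,z,w] :: 'a::zero^4)$1 = x"
  "(vector [x,y,z,w] :: 'a^4)$2 = y"
  "(vector [x,y,z,w] :: 'a^4)$3 = z"
  "(vector [x,y,z,w] :: 'a^4)$4 = w"
  by (simp_all add: vector_def)

definition skew :: "real^4^4 \<Rightarrow> bool" where
  "skew A \<longleftrightarrow> (\<forall>i j. A$i$j = - A$j$i)"

definition pf :: "real^4^4 \<Rightarrow> real" where
  "pf A = A$1$2 * A$3$4 - A$1$3 * A$2$4 + A$1$4 * A$2$3"

text \<open>Polarisation of the quadratic form \<open>pf\<close>; unrelated to polar points.\<close>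

definition pf_polar :: "real^4^4 \<Rightarrow> real^4^4 \<Rightarrow> real" where
  "pf_polar A B = A$1$2 * B$3$4 + B$1$2 * A$3$4 - A$1$3 * B$2$4 - B$1$3 * A$2$4 + A$1$4 * B$2$3 + B$1$4 * A$2$3"

text \<open>Pfaffian counterpart of the adjugate: for skew \<open>A\<close> the adjugate is
  \<open>pf A\<close> times this matrix. In size four its entries are linear in
  \<open>A\<close>.\<close>

definition pf_adj :: "real^4^4 \<Rightarrow> real^4^4" where
  "pf_adj A = vector [vector [0, - A$3$4, A$2$4, - A$2$3],
                      vector [A$3$4, 0, - A$1$4, A$1$3],
                      vector [- A$2$4, A$1$4, 0, - A$1$2],
                      vector [A$2$3, - A$1$3, A$1$2, 0]]"

lemma skew_entries:
  assumes "skew A"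
  shows "A$1$1 = 0" "A$2$2 = 0" "A$3$3 = 0" "A$4$4 = 0"
    "A$2$1 = - A$1$2" "A$3$1 = - A$1$3" "A$4$1 = - A$1$4" "A$3$2 = - A$2$3" "A$4$2 = - A$2$4" "A$4$3 = - A$3$4"
proof -
  have sk: "A$i$j = - A$j$i" for i j using assms unfolding skew_def by blast
  have d: "A$i$i = 0" for i using sk[of i i] by simp
  show "A$1$1 = 0" "A$2$2 = 0" "A$3$3 = 0" "A$4$4 = 0" by (rule d)+
  show "A$2$1 = - A$1$2" "A$3$1 = - A$1$3" "A$4$1 = - A$1$4" "A$3$2 = - A$2$3" "A$4$2 = - A$2$4" "A$4$3 = - A$3$4"
    by (rule sk)+
qed

lemma pf_adj_mult:
  assumes "skew A"
  shows "A ** pf_adj A = pf A *\<^sub>R mat 1" "pf_adj A ** A = pf A *\<^sub>R mat 1"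
  by (simp_all add: vec_eq_iff forall_4 matrix_matrix_mult_def sum_4 pf_adj_def vector_4 mat_def pf_def
      skew_entries[OF assms] algebra_simps)

text \<open>This is the coefficient of \<open>t\<close> in \<open>pf_adj_mult\<close> applied to
  \<open>A + t B\<close>.\<close>

lemma pf_adj_polar:
  assumes "skew A" "skew B"
  shows "pf_adj A ** B + pf_adj B ** A = pf_polar A B *\<^sub>R mat 1"
  by (simp add: vec_eq_iff forall_4 matrix_matrix_mult_def sum_4 pf_adj_def vector_4 mat_def pf_def pf_polar_def
      skew_entries[OF assms(1)] skew_entries[OF assms(2)] algebra_simps)

lemma pf_add:
  "pf (t *\<^sub>R A + B) = t\<^sup>2 * pf A + t * pf_polar A B + pf B"
  by (simp add: pf_def pf_polar_def power2_eq_square algebra_simps)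

text \<open>Multiplicativity of \<open>det\<close> yields only the square of this identity; the
  direct expansion fixes the sign.\<close>

lemma pf_congruence:
  assumes "skew A"
  shows "pf (transpose M ** A ** M) = det M * pf A"
  unfolding pf_def det_4 matrix_matrix_mult_def transpose_def
  by (simp only: vec_lambda_beta sum_4 skew_entries[OF assms]) algebra


text \<open>Every vector in the range of \<open>pf_adj C\<close> is killed by \<open>C\<close>. That
  range is trivial only for \<open>C = 0\<close>, as \<open>pf_adj\<close> merely rearranges the
  entries up to sign.\<close>

lemma skew_singular:
  assumes "skew C" "pf C = 0"
  obtains v where "v \<noteq> 0" "C *v v = 0"
proof (cases "pf_adj C = 0")
  case True
  have *: "pf_adj C $ i $ j = 0" for i j
    by (simp add: True)
  have "C = 0"
    using *[of 1 2] *[of 1 3] *[of 1 4] *[of 2 3] *[of 2 4] *[of 3 4]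
    by (simp add: vec_eq_iff forall_4 skew_entries[OF assms(1)] pf_adj_def vector_4)
  then show ?thesis
    using that[of "axis 1 1"] by (simp add: axis_eq_0_iff)
next
  case False
  then obtain x where "pf_adj C *v x \<noteq> 0"
    using matrix_eq[of "pf_adj C" 0] by auto
  moreover have "C *v (pf_adj C *v x) = 0"
    by (simp add: matrix_vector_mul_assoc pf_adj_mult[OF assms(1)] assms(2))
  ultimately show ?thesis
    using that by blast
qed

section \<open>Projective quadrics and their tangent planes\<close>

lemma span_singleton_eq_iff:
  fixes v w :: "'a::real_vector"
  shows "span {v} = span {w} \<longleftrightarrow> (\<exists>k. k \<noteq> 0 \<and> w = k *\<^sub>R v)"
proof
  assume *: "span {v} = span {w}"
  then have "w \<in> span {v}" "v \<in> span {w}"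
    by (auto intro: span_base)
  then obtain k l where k: "w = k *\<^sub>R v" "v = l *\<^sub>R w"
    unfolding span_singleton by blast
  show "\<exists>k. k \<noteq> 0 \<and> w = k *\<^sub>R v"
  proof (cases "k = 0")
    case True
    then have "w = 1 *\<^sub>R v" using k by simp
    then show ?thesis by force
  qed (use k in auto)
next
  assume "\<exists>k. k \<noteq> 0 \<and> w = k *\<^sub>R v"
  then obtain k where k: "k \<noteq> 0" "w = k *\<^sub>R v" by auto
  then have "v = inverse k *\<^sub>R w" by simp
  with k have "w \<in> span {v}" "v \<in> span {w}"
    unfolding span_singleton by blast+
  then show "span {v} = span {w}"
    by (simp add: span_eq)
qed

lemma span_scale_singleton:
  fixes v :: "'a::real_vector"
  shows "k \<noteq> 0 \<Longrightarrow> span {k *\<^sub>R v} = span {v}"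
  using span_singleton_eq_iff[of v "k *\<^sub>R v"] by auto

lemma mem_projective_locus_iff:
  fixes v :: "'a::real_vector"
  assumes "\<And>k v. k \<noteq> 0 \<Longrightarrow> P v \<Longrightarrow> P (k *\<^sub>R v)"
  shows "span {v} \<in> {span {v} | v. v \<noteq> 0 \<and> P v} \<longleftrightarrow> v \<noteq> 0 \<and> P v"
proof
  assume "span {v} \<in> {span {v} | v. v \<noteq> 0 \<and> P v}"
  then obtain w where "span {w} = span {v}" "w \<noteq> 0" "P w" by auto
  then show "v \<noteq> 0 \<and> P v"
    using assms unfolding span_singleton_eq_iff by auto
qed blast

lemma mem_quadric_iff:
  assumes "linear Q"
  shows "span {v} \<in> quadric Q \<longleftrightarrow> v \<noteq> 0 \<and> Q v v = 0"
  unfolding quadric_def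
  by (rule mem_projective_locus_iff) (simp add: linear_scale[OF assms] blinfun.bilinear_simps)

text \<open>One inclusion differentiates \<open>Q\<close> along the curve. For the other,
  \<open>Q u\<close> being nonzero gives a transversal direction in which \<open>u + t w\<close> can
  be corrected back onto the cone.\<close>

lemma tangent_plane_quadric:
  assumes Q: "symmetric_form Q" and u: "u \<noteq> 0" "Q u u = 0" "Q u \<noteq> 0"
  shows "tangent_plane (quadric Q) (span {u}) = {w. Q u w = 0}"
proof
  have lin: "linear Q" and sym: "\<And>u v. Q u v = Q v u"
    using Q by (auto simp: symmetric_form_def)
  note bil = linear_add[OF lin] linear_diff[OF lin] linear_scale[OF lin] blinfun.bilinear_simps
  have bl: "bounded_linear Q" using lin by (rule linear_conv_bounded_linear[THEN iffD1])
  show "tangent_plane (quadric Q) (span {u}) \<subseteq> {w. Q u w = 0}"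
  proof
    fix w assume "w \<in> tangent_plane (quadric Q) (span {u})"
    then obtain \<gamma> :: "real \<Rightarrow> V" where g: "span {\<gamma> 0} = span {u}"
      "\<forall>\<^sub>F t in nhds 0. span {\<gamma> t} \<in> quadric Q" "(\<gamma> has_vector_derivative w) (at 0)"
      by (auto simp: tangent_plane_def)
    have ev: "\<forall>\<^sub>F t in nhds 0. Q (\<gamma> t) (\<gamma> t) = 0"
      using g(2) by eventually_elim (simp add: mem_quadric_iff[OF lin])
    have "((\<lambda>t. Q (\<gamma> t) (\<gamma> t)) has_vector_derivative Q (\<gamma> 0) w + Q w (\<gamma> 0)) (at 0)"
      by (intro bounded_bilinear.has_vector_derivative[OF bounded_bilinear_blinfun_apply]
          bounded_linear.has_vector_derivative[OF bl] g(3))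
    then have "((\<lambda>t. Q (\<gamma> t) (\<gamma> t)) has_field_derivative 2 * Q (\<gamma> 0) w) (at 0)"
      by (simp add: has_real_derivative_iff_has_vector_derivative sym[of w])
    then have "((\<lambda>t::real. 0) has_field_derivative 2 * Q (\<gamma> 0) w) (at 0)"
      using DERIV_cong_ev[OF refl ev refl] by blast
    then have "Q (\<gamma> 0) w = 0"
      using DERIV_unique[OF _ DERIV_const] by fastforce
    then show "w \<in> {w. Q u w = 0}"
      using g(1) unfolding span_singleton_eq_iff by (auto simp: bil)
  qed
  show "{w. Q u w = 0} \<subseteq> tangent_plane (quadric Q) (span {u})"
  proof
    fix w assume "w \<in> {w. Q u w = 0}"
    then have w: "Q u w = 0" by simp
    txt \<open>A vector \<open>n\<close> isotropic and transversal to the tangent plane corrects \<open>u + t w\<close> to second order.\<close>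
    obtain m where "Q u m \<noteq> 0"
      using u(3) by (metis blinfun_eqI zero_blinfun.rep_eq)
    define m' where "m' = m /\<^sub>R Q u m"
    have m': "Q u m' = 1" using \<open>Q u m \<noteq> 0\<close> by (simp add: m'_def bil)
    define n where "n = m' - (Q m' m' / 2) *\<^sub>R u"
    have n: "Q u n = 1" "Q n n = 0"
      using m' sym[of m' u] u(2) by (simp_all add: n_def bil)
    \<comment> \<open>Since \<open>n\<close> is isotropic, the equation for the correction is linear
      in \<open>f t\<close>: \<open>t^2 Q w w + 2 f t (1 + t Q w n) = 0\<close>.\<close>
    define f where "f t = - (t\<^sup>2 * Q w w / (2 * (1 + t * Q w n)))" for t
    define \<gamma> where "\<gamma> t = u + t *\<^sub>R w + f t *\<^sub>R n" for t :: real
    have f: "(f has_field_derivative 0) (at 0)"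
      unfolding f_def by (auto intro!: derivative_eq_intros)
    have d: "(\<gamma> has_vector_derivative w) (at 0)"
      unfolding \<gamma>_def using f by (auto intro!: derivative_eq_intros simp: f_def)
    have g0: "\<gamma> 0 = u" by (simp add: \<gamma>_def f_def)
    have "isCont \<gamma> 0" using d by (rule has_vector_derivative_continuous)
    then have ev1: "\<forall>\<^sub>F t in nhds 0. \<gamma> t \<noteq> 0"
      using tendsto_imp_eventually_ne[of \<gamma> "\<gamma> 0" "at 0" 0] u(1) g0
      by (simp add: isCont_def eventually_nhds_conv_at)
    have "isCont (\<lambda>t. 1 + t * Q w n) 0" by simp
    then have ev2: "\<forall>\<^sub>F t in nhds 0. 1 + t * Q w n \<noteq> 0"
      using tendsto_imp_eventually_ne[of "\<lambda>t. 1 + t * Q w n" 1 "at 0" 0]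
      by (simp add: isCont_def eventually_nhds_conv_at)
    have "\<forall>\<^sub>F t in nhds 0. span {\<gamma> t} \<in> quadric Q"
      using ev1 ev2
    proof eventually_elim
      case (elim t)
      have "Q (\<gamma> t) (\<gamma> t) = t\<^sup>2 * Q w w + 2 * f t * (1 + t * Q w n)"
        using u(2) n w sym[of n u] sym[of w u] sym[of n w]
        by (simp add: \<gamma>_def bil power2_eq_square algebra_simps)
      also have "\<dots> = 0"
        using elim(2) by (simp add: f_def field_simps)
      finally show ?case using elim(1) by (simp add: mem_quadric_iff[OF lin])
    qed
    then show "w \<in> tangent_plane (quadric Q) (span {u})"
      unfolding tangent_plane_def using d g0 by blast
  qed
qed

lemma eq_scaleR_inverse_iff:
  fixes x v :: "'a::real_vector"
  shows "a \<noteq> 0 \<Longrightarrow> x = (1 / a) *\<^sub>R v \<longleftrightarrow> a *\<^sub>R x = v"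
  by auto

definition lin_indep2 :: "'a::real_vector \<Rightarrow> 'a \<Rightarrow> bool" where
  "lin_indep2 x y \<longleftrightarrow> (\<forall>\<alpha> \<beta>. \<alpha> *\<^sub>R x + \<beta> *\<^sub>R y = 0 \<longrightarrow> \<alpha> = 0 \<and> \<beta> = 0)"

lemma lin_indep2I:
  assumes "x \<noteq> 0" "\<And>k. y \<noteq> k *\<^sub>R x"
  shows "lin_indep2 x y"
  unfolding lin_indep2_def
proof (intro allI impI)
  fix \<alpha> \<beta> :: real assume *: "\<alpha> *\<^sub>R x + \<beta> *\<^sub>R y = 0"
  have "\<beta> = 0"
  proof (rule ccontr)
    assume b: "\<beta> \<noteq> 0"
    have "\<beta> *\<^sub>R y = (- \<alpha>) *\<^sub>R x" using * by (simp add: add_eq_0_iff)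
    then have "y = (1 / \<beta>) *\<^sub>R ((- \<alpha>) *\<^sub>R x)" using eq_scaleR_inverse_iff[OF b] by blast
    then show False using assms(2)[of "- (\<alpha> / \<beta>)"] by simp
  qed
  with * assms(1) show "\<alpha> = 0 \<and> \<beta> = 0" by simp
qed

text \<open>Points of a projective line are separated by a two-by-two determinant; families of
  correspondents lying on one line are shown injective this way.\<close>

lemma lin_indep2_span_eq:
  assumes "lin_indep2 x y" "span {a *\<^sub>R x + b *\<^sub>R y} = span {a' *\<^sub>R x + b' *\<^sub>R y}"
  shows "a * b' = a' * b"
proof -
  obtain k where "a' *\<^sub>R x + b' *\<^sub>R y = k *\<^sub>R (a *\<^sub>R x + b *\<^sub>R y)"
    using assms(2) by (auto simp: span_singleton_eq_iff)
  then have "(a' - k * a) *\<^sub>R x + (b' - k * b) *\<^sub>R y = 0"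
    by (simp add: algebra_simps)
  then have "a' - k * a = 0" "b' - k * b = 0" using assms(1) unfolding lin_indep2_def by blast+
  then have "a' = k * a" "b' = k * b" by simp_all
  then show ?thesis by simp
qed

section \<open>The generator and its even characteristic polynomial\<close>

locale symplectic_quadric =
  fixes \<omega> S S' :: "V \<Rightarrow> V_dual" and X :: "V \<Rightarrow> V"
  assumes symplectic: "symplectic_form \<omega>"
    and symmetric: "symmetric_form S"
    and bij_S: "bij S"
    and X_eq: "X = inv \<omega> \<circ> S"
    and S'_eq: "S' = (\<lambda>v. - \<omega> (inv S (\<omega> v)))"
begin

lemma bij_omega: "bij \<omega>" and linear_omega: "linear \<omega>" and omega_self [simp]: "\<omega> v v = 0"
  using symplectic by (auto simp: symplectic_form_def)

lemma linear_S: "linear S" and S_sym: "S u v = S v u"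
  using symmetric by (auto simp: symmetric_form_def)

lemmas omega_linear = linear_add[OF linear_omega] linear_diff[OF linear_omega] linear_scale[OF linear_omega]
  linear_neg[OF linear_omega] linear_0[OF linear_omega]
lemmas omega_bilinear = omega_linear blinfun.bilinear_simps

lemma omega_skew: "\<omega> u v = - \<omega> v u"
  using omega_self[of "u + v"] by (simp add: omega_bilinear)

lemma omega_nondegenerate: "(\<And>v. \<omega> u v = 0) \<Longrightarrow> u = 0"
  by (metis bij_omega bij_is_inj blinfun_eqI injD linear_0 linear_omega zero_blinfun.rep_eq)

lemma S_omega: "S u = \<omega> (X u)"
  by (simp add: X_eq surj_f_inv_f[OF bij_is_surj[OF bij_omega]])

lemma bij_X: "bij X"
  by (simp add: X_eq bij_comp bij_S bij_imp_bij_inv bij_omega)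

lemma linear_X: "linear X"
proof -
  have i: "inj \<omega>" using bij_omega by (rule bij_is_inj)
  show ?thesis
  proof
    show "X (u + v) = X u + X v" for u v
      by (rule injD[OF i]) (simp add: S_omega[symmetric] omega_linear linear_add[OF linear_S])
    show "X (r *\<^sub>R u) = r *\<^sub>R X u" for r u
      by (rule injD[OF i]) (simp add: S_omega[symmetric] omega_linear linear_scale[OF linear_S])
  qed
qed

lemmas X_linear = linear_add[OF linear_X] linear_diff[OF linear_X] linear_scale[OF linear_X]
  linear_neg[OF linear_X] linear_0[OF linear_X]

lemma X_eq_0_iff [simp]: "X u = 0 \<longleftrightarrow> u = 0"
  using bij_X linear_X by (metis bij_is_inj injD linear_0)

lemma omega_X: "\<omega> (X u) v = - \<omega> u (X v)"
  using S_sym[of u v] omega_skew[of "X v" u] by (simp add: S_omega)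

lemma X_inv_X [simp]: "X (inv X u) = u" and inv_X_X [simp]: "inv X (X u) = u"
  using bij_X by (simp_all add: bij_is_surj surj_f_inv_f bij_is_inj)

lemma S'_omega: "S' u = - \<omega> (inv X u)"
proof -
  have "S (inv X u) = \<omega> u" by (simp add: S_omega)
  then have "inv S (\<omega> u) = inv X u"
    using bij_S by (metis bij_is_inj inv_f_f)
  then show ?thesis by (simp add: S'_eq)
qed

lemma S'_X: "S' (X u) = - \<omega> u"
  by (simp add: S'_omega)

definition omega_mat where "omega_mat = (\<chi> i j. \<omega> (axis i 1) (axis j 1))"

lemma inner_omega_mat: "u \<bullet> (omega_mat *v v) = \<omega> u v"
proof -
  have e: "x = (\<Sum>i\<in>UNIV. x $ i *\<^sub>R axis i 1)" for x :: V
    by (simp add: basis_expansion scalar_mult_eq_scaleR[symmetric])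
  have "\<omega> u v = \<omega> (\<Sum>i\<in>UNIV. u $ i *\<^sub>R axis i 1) (\<Sum>i\<in>UNIV. v $ i *\<^sub>R axis i 1)"
    using e by metis
  also have "\<dots> = u \<bullet> (omega_mat *v v)"
    by (simp add: linear_sum[OF linear_omega] omega_bilinear blinfun.sum_left blinfun.sum_right
        omega_mat_def inner_vec_def matrix_vector_mult_def sum_distrib_left mult_ac)
      (rule sum.swap)
  finally show ?thesis by simp
qed

lemma skew_omega_mat: "skew omega_mat"
  unfolding skew_def omega_mat_def by (simp add: omega_skew[symmetric])

lemma omega_mat_eq_0D: "omega_mat *v v = 0 \<Longrightarrow> v = 0"
  by (metis inner_omega_mat inner_zero_right omega_nondegenerate omega_skew neg_equal_0_iff_equal)

lemma pf_omega_mat: "pf omega_mat \<noteq> 0"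
  using skew_singular[OF skew_omega_mat] omega_mat_eq_0D by blast

definition X_mat where "X_mat = matrix X"

lemma X_eq_mat: "X v = X_mat *v v"
  using linear_X by (simp add: X_mat_def)

text \<open>
  This matrix \<open>X\<^sup>T \<omega> X\<close> equals \<open>- \<omega> X\<^sup>2\<close>, so \<open>\<omega> (t - X\<^sup>2)\<close> is skew; its Pfaffian is \<open>Pf \<omega>\<close> times
  \<open>t\<^sup>2 + c t + d\<close>, and the congruence rule for the Pfaffian gives \<open>d = det X\<close> with the correct sign.
\<close>

definition pullback_mat where "pullback_mat = transpose X_mat ** omega_mat ** X_mat"

lemma inner_pullback_mat: "u \<bullet> (pullback_mat *v v) = \<omega> (X u) (X v)"
proof -
  have "u \<bullet> (transpose X_mat *v y) = (X_mat *v u) \<bullet> y" for y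
    using dot_lmul_matrix[of y X_mat u] by (simp add: transpose_matrix_vector inner_commute)
  then show ?thesis
    by (simp add: pullback_mat_def inner_omega_mat[symmetric] X_eq_mat matrix_vector_mul_assoc[symmetric])
qed

lemma skew_pullback_mat: "skew pullback_mat"
proof -
  have "pullback_mat $ i $ j = \<omega> (X (axis i 1)) (X (axis j 1))" for i j
    unfolding inner_pullback_mat[symmetric] by (simp add: inner_axis' matrix_vector_mul_component inner_axis)
  then show ?thesis
    unfolding skew_def by (simp add: omega_skew[symmetric])
qed

lemma pullback_mat_mult: "pullback_mat *v v = - (omega_mat *v X (X v))"
proof -
  have "u \<bullet> (pullback_mat *v v) = u \<bullet> (- (omega_mat *v X (X v)))" for u
    by (simp add: inner_omega_mat omega_X inner_pullback_mat)
  then show ?thesis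
    by (meson vector_eq_ldot)
qed

text \<open>In invariant terms, \<open>c\<close> is minus half the trace of
  \<open>X^2\<close>.\<close>

definition c where "c = pf_polar omega_mat pullback_mat / pf omega_mat"

definition d where "d = det (matrix X)"

lemma pf_pullback_mat: "pf pullback_mat = d * pf omega_mat"
  unfolding pullback_mat_def d_def X_mat_def by (rule pf_congruence[OF skew_omega_mat])

text \<open>Multiplying \<open>pf_adj_polar\<close> on the left by \<open>pullback_mat\<close>,
  which acts as \<open>- omega_mat X^2\<close>, makes the second term \<open>pf pullback_mat\<close>
  times \<open>omega_mat\<close> and the first \<open>pf omega_mat\<close> times
  \<open>omega_mat X^4\<close>. Then \<open>omega_mat\<close> is cancelled.\<close>

lemma cayley_hamilton: "X (X (X (X v))) + c *\<^sub>R X (X v) + d *\<^sub>R v = 0"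
proof -
  have adj: "pf_adj omega_mat *v (omega_mat *v x) = pf omega_mat *\<^sub>R x" for x
    by (simp add: matrix_vector_mul_assoc pf_adj_mult[OF skew_omega_mat] flip: scaleR_matrix_vector_assoc)
  have "pf_adj omega_mat *v (pullback_mat *v x) + pf_adj pullback_mat *v (omega_mat *v x) = pf_polar omega_mat pullback_mat *\<^sub>R x" for x
    using arg_cong[OF pf_adj_polar[OF skew_omega_mat skew_pullback_mat], of "\<lambda>F. F *v x"]
    by (simp add: matrix_vector_mul_assoc matrix_vector_mult_add_rdistrib flip: scaleR_matrix_vector_assoc)
  then have 1: "pullback_mat *v (pf_adj omega_mat *v (pullback_mat *v v)) = pf_polar omega_mat pullback_mat *\<^sub>R (pullback_mat *v v) - pullback_mat *v (pf_adj pullback_mat *v (omega_mat *v v))"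
    by (metis (no_types, lifting) add_diff_cancel_right' matrix_vector_mult_diff_distrib matrix_vector_mult_scaleR)
  have 2: "pullback_mat *v (pf_adj pullback_mat *v (omega_mat *v v)) = pf pullback_mat *\<^sub>R (omega_mat *v v)"
    by (simp add: matrix_vector_mul_assoc[of pullback_mat] pf_adj_mult[OF skew_pullback_mat] flip: scaleR_matrix_vector_assoc)
  have 3: "pullback_mat *v (pf_adj omega_mat *v (pullback_mat *v v)) = pf omega_mat *\<^sub>R (omega_mat *v X (X (X (X v))))"
    by (simp add: pullback_mat_mult adj matrix_vector_mult_scaleR linear_neg[OF matrix_vector_mul_linear] X_linear)
  have "omega_mat *v (pf omega_mat *\<^sub>R X (X (X (X v))) + pf_polar omega_mat pullback_mat *\<^sub>R X (X v) + (d * pf omega_mat) *\<^sub>R v) = 0"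
    using 1 unfolding 2 3 by (simp add: pullback_mat_mult pf_pullback_mat matrix_vector_right_distrib matrix_vector_mult_scaleR)
  then have *: "pf omega_mat *\<^sub>R X (X (X (X v))) + pf_polar omega_mat pullback_mat *\<^sub>R X (X v) + (d * pf omega_mat) *\<^sub>R v = 0"
    by (rule omega_mat_eq_0D)
  have "pf omega_mat *\<^sub>R (X (X (X (X v))) + c *\<^sub>R X (X v) + d *\<^sub>R v) = 0"
    using * pf_omega_mat by (simp add: c_def scaleR_add_right mult.commute)
  then show ?thesis
    using pf_omega_mat by simp
qed

text \<open>At a root the skew matrix of \<open>\<omega> (t - X^2)\<close> has Pfaffian zero, hence
  a kernel.\<close>

lemma char_root_eigenvector:
  assumes "t\<^sup>2 + c * t + d = 0"
  obtains v where "v \<noteq> 0" "X (X v) = t *\<^sub>R v"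
proof -
  have "pf (t *\<^sub>R omega_mat + pullback_mat) = pf omega_mat * (t\<^sup>2 + c * t + d)"
    unfolding pf_add pf_pullback_mat c_def using pf_omega_mat by (simp add: field_simps)
  moreover have "skew (t *\<^sub>R omega_mat + pullback_mat)"
    unfolding skew_def
  proof (intro allI)
    fix i j
    have "omega_mat $ i $ j = - omega_mat $ j $ i" "pullback_mat $ i $ j = - pullback_mat $ j $ i"
      using skew_omega_mat skew_pullback_mat unfolding skew_def by blast+
    then show "(t *\<^sub>R omega_mat + pullback_mat) $ i $ j = - (t *\<^sub>R omega_mat + pullback_mat) $ j $ i"
      by simp
  qed
  ultimately obtain v where v: "v \<noteq> 0" "(t *\<^sub>R omega_mat + pullback_mat) *v v = 0"
    using skew_singular assms by (metis mult_zero_right)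
  have "omega_mat *v (t *\<^sub>R v - X (X v)) = 0"
    using v(2) by (simp add: pullback_mat_mult matrix_vector_mult_add_rdistrib matrix_vector_mult_diff_distrib
      matrix_vector_mult_scaleR flip: scaleR_matrix_vector_assoc)
  then show ?thesis
    using that[of v] v(1) omega_mat_eq_0D by fastforce
qed

lemma d_nonzero: "d \<noteq> 0"
  using bij_X linear_X by (simp add: d_def det_nz_iff_inj bij_is_inj)

section \<open>Polar points and the correspondence\<close>

text \<open>A functional vanishing on the kernel of a nonzero functional is a multiple of it;
  nondegeneracy carries this over to vectors.\<close>

lemma complement_kernel:
  assumes "x \<noteq> 0"
  shows "symplectic_complement \<omega> {w. \<omega> x w = 0} = span {x}"
proof -
  obtain m where "\<omega> x m \<noteq> 0"
    using assms omega_nondegenerate by blast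
  have "v \<in> span {x}" if v: "\<And>w. \<omega> x w = 0 \<Longrightarrow> \<omega> v w = 0" for v
  proof -
    have "\<omega> (v - (\<omega> v m / \<omega> x m) *\<^sub>R x) w = 0" for w
      using v[of "w - (\<omega> x w / \<omega> x m) *\<^sub>R m"] \<open>\<omega> x m \<noteq> 0\<close>
      by (simp add: omega_bilinear)
    then have "v - (\<omega> v m / \<omega> x m) *\<^sub>R x = 0"
      by (rule omega_nondegenerate)
    then show ?thesis by (auto simp: span_singleton)
  qed
  then show ?thesis
    by (auto simp: symplectic_complement_def span_singleton omega_bilinear)
qed

lemma linear_S': "linear S'"
proof
  have "linear (inv X)" using linear_X bij_X by (metis inj_linear_imp_inv_linear bij_is_inj)
  note l = linear_add[OF this] linear_scale[OF this]
  show "S' (u + v) = S' u + S' v" "S' (r *\<^sub>R u) = r *\<^sub>R S' u" for u v r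
    by (simp_all add: S'_omega l omega_linear)
qed

lemma symmetric_S': "symmetric_form S'"
proof -
  have "S' (X u) (X v) = S' (X v) (X u)" for u v
    using omega_X[of u v] omega_skew[of v "X u"] by (simp add: S'_X blinfun.bilinear_simps)
  then have "S' u v = S' v u" for u v
    by (metis X_inv_X)
  then show ?thesis by (simp add: symmetric_form_def linear_S')
qed

lemma bij_S': "bij S'"
proof (rule bijI)
  show "inj S'"
    unfolding linear_injective_0[OF linear_S']
  proof (intro allI impI)
    fix u assume "S' u = 0"
    then have "\<omega> (inv X u) v = 0" for v by (simp add: S'_omega)
    then have "inv X u = 0" by (rule omega_nondegenerate)
    then show "u = 0" using X_inv_X[of u] by (simp add: X_linear del: X_inv_X)
  qed
  show "surj S'"
  proof (rule surjI)
    show "S' (X (inv \<omega> (- y))) = y" for y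
      by (simp add: S'_X surj_f_inv_f[OF bij_is_surj[OF bij_omega]])
  qed
qed

lemma polar_point_S:
  assumes "u \<noteq> 0" "S u u = 0"
  shows "polar_point \<omega> (quadric S) (span {u}) = span {X u}"
proof -
  have "S u \<noteq> 0" 
    using assms bij_S linear_S by (metis bij_is_inj injD linear_0)
  then have "tangent_plane (quadric S) (span {u}) = {w. \<omega> (X u) w = 0}"
    using tangent_plane_quadric[OF symmetric assms] unfolding S_omega[of u] by simp
  then show ?thesis
    using complement_kernel[of "X u"] assms by (simp add: polar_point_def)
qed

text \<open>Because \<open>S' (X u) = - \<omega> u\<close>, polarity over the polar surface leads
  from \<open>X u\<close> back to \<open>u\<close>.\<close>

lemma polar_point_S':
  assumes "u \<noteq> 0" "S' (X u) (X u) = 0"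
  shows "polar_point \<omega> (quadric S') (span {X u}) = span {u}"
proof -
  have "S' (X u) \<noteq> 0" 
    using assms bij_S' linear_S' by (metis bij_is_inj injD linear_0 X_eq_0_iff)
  then have "tangent_plane (quadric S') (span {X u}) = {w. \<omega> u w = 0}"
    using tangent_plane_quadric[OF symmetric_S' _ assms(2)] assms(1) by (simp add: S'_X blinfun.bilinear_simps)
  then show ?thesis
    using complement_kernel[of u] assms by (simp add: polar_point_def)
qed

lemma S'_X_X: "S' (X u) (X v) = S u v"
  using omega_X[of u v] by (simp add: S'_X S_omega blinfun.bilinear_simps)

lemma polar_surface_S: "polar_surface \<omega> (quadric S) = quadric S'"
proof
  show "polar_surface \<omega> (quadric S) \<subseteq> quadric S'"
  proof
    fix p assume "p \<in> polar_surface \<omega> (quadric S)"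
    then obtain q where q: "q \<in> quadric S" "p = polar_point \<omega> (quadric S) q"
      by (auto simp: polar_surface_def)
    then obtain u where "q = span {u}" "u \<noteq> 0" "S u u = 0" by (auto simp: quadric_def)
    then show "p \<in> quadric S'"
      using q(2) by (simp add: polar_point_S mem_quadric_iff[OF linear_S'] S'_X_X)
  qed
  show "quadric S' \<subseteq> polar_surface \<omega> (quadric S)"
  proof
    fix q assume "q \<in> quadric S'"
    then obtain v where v: "q = span {v}" "v \<noteq> 0" "S' v v = 0" by (auto simp: quadric_def)
    define u where "u = inv X v"
    have "v = X u" by (simp add: u_def)
    with v have u: "q = span {X u}" "u \<noteq> 0" "S u u = 0"
      by (auto simp: S'_X_X)
    then have "q = polar_point \<omega> (quadric S) (span {u})" "span {u} \<in> quadric S"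
      by (simp_all add: polar_point_S mem_quadric_iff[OF linear_S])
    then show "q \<in> polar_surface \<omega> (quadric S)"
      by (auto simp: polar_surface_def)
  qed
qed

text \<open>The correspondence over either of the two surfaces, see \<open>corr_S\<close> and \<open>corr_S'\<close>.\<close>

definition corr :: "V set \<Rightarrow> V set \<Rightarrow> bool" where
  "corr Z Z' \<longleftrightarrow> (\<exists>u a. a \<noteq> 0 \<and> S u u = 0 \<and> (\<nexists>k. X u = k *\<^sub>R u) \<and>
     Z = span {u + a *\<^sub>R X u} \<and> Z' = span {u - a *\<^sub>R X u})"

lemma span_X_eq_iff: "u \<noteq> 0 \<Longrightarrow> span {X u} = span {u} \<longleftrightarrow> (\<exists>k. X u = k *\<^sub>R u)"
proof -
  assume "u \<noteq> 0"
  then have "k \<noteq> 0" if "X u = k *\<^sub>R u" for k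
    using that X_eq_0_iff[of u] by auto
  then show ?thesis
    using span_singleton_eq_iff[of u "X u"] by auto
qed

lemma nonparallel_nonzero: "\<nexists>k. X u = k *\<^sub>R u \<Longrightarrow> u \<noteq> 0"
  by auto

lemma corr_S: "outer_correspondence \<omega> (quadric S) Z Z' \<longleftrightarrow> corr Z Z'"
proof
  assume "outer_correspondence \<omega> (quadric S) Z Z'"
  then obtain u u' where u: "span {u} \<in> quadric S" "polar_point \<omega> (quadric S) (span {u}) \<noteq> span {u}"
    "u \<noteq> 0" "u' \<noteq> 0" "polar_point \<omega> (quadric S) (span {u}) = span {u'}"
    "Z = span {u + u'}" "Z' = span {u - u'}"
    unfolding outer_correspondence_def by metis
  then have S: "S u u = 0" by (simp add: mem_quadric_iff[OF linear_S])
  then obtain a where "a \<noteq> 0" "u' = a *\<^sub>R X u"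
    using u(3,5) by (auto simp: polar_point_S span_singleton_eq_iff)
  moreover have "\<nexists>k. X u = k *\<^sub>R u"
    using u(2,3) S by (simp add: polar_point_S span_X_eq_iff)
  ultimately show "corr Z Z'"
    unfolding corr_def using u(6,7) S by blast
next
  assume "corr Z Z'"
  then obtain u a where u: "a \<noteq> 0" "S u u = 0" "\<nexists>k. X u = k *\<^sub>R u"
     "Z = span {u + a *\<^sub>R X u}" "Z' = span {u - a *\<^sub>R X u}" 
    unfolding corr_def by auto
  have "u \<noteq> 0" using u(3) by (rule nonparallel_nonzero)
  have "a *\<^sub>R X u \<noteq> 0" using u \<open>u \<noteq> 0\<close> by simp
  have "polar_point \<omega> (quadric S) (span {u}) = span {a *\<^sub>R X u}"
    using u \<open>u \<noteq> 0\<close> by (simp add: polar_point_S span_scale_singleton)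
  moreover have "polar_point \<omega> (quadric S) (span {u}) \<noteq> span {u}"
    using u \<open>u \<noteq> 0\<close> by (simp add: polar_point_S span_X_eq_iff)
  ultimately show "outer_correspondence \<omega> (quadric S) Z Z'"
    unfolding outer_correspondence_def using u(2,4,5) \<open>u \<noteq> 0\<close> \<open>a *\<^sub>R X u \<noteq> 0\<close>
    by (intro bexI[of _ "span {u}"]) (blast, simp add: mem_quadric_iff[OF linear_S])
qed

text \<open>Polarity exchanges the two base points of the harmonic pair. With lifts
  \<open>X u\<close> and \<open>b u\<close> the pair is unchanged up to factors:
  \<open>X u + b u = b (u + X u / b)\<close> and \<open>X u - b u = - b (u - X u / b)\<close>, so
  the parameter becomes \<open>1 / b\<close>.\<close>

lemma corr_S': "outer_correspondence \<omega> (quadric S') Z Z' \<longleftrightarrow> corr Z Z'"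
proof
  assume "outer_correspondence \<omega> (quadric S') Z Z'"
  then obtain v u' where u: "span {v} \<in> quadric S'" "polar_point \<omega> (quadric S') (span {v}) \<noteq> span {v}"
    "v \<noteq> 0" "u' \<noteq> 0" "polar_point \<omega> (quadric S') (span {v}) = span {u'}"
    "Z = span {v + u'}" "Z' = span {v - u'}"
    unfolding outer_correspondence_def by metis
  obtain u where v: "v = X u" by (metis X_inv_X)
  have S: "S' v v = 0" using u by (simp add: mem_quadric_iff[OF linear_S'])
  then have S0: "S u u = 0" by (simp add: v S'_X_X)
  have "u \<noteq> 0" using u v by auto
  then obtain b where b: "b \<noteq> 0" "u' = b *\<^sub>R u"
    using u(5) S by (auto simp: v polar_point_S' span_singleton_eq_iff)
  have e: "v + u' = b *\<^sub>R (u + inverse b *\<^sub>R X u)" "v - u' = (-b) *\<^sub>R (u - inverse b *\<^sub>R X u)"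
    using b by (simp_all add: v algebra_simps)
  have "Z = span {u + inverse b *\<^sub>R X u}" "Z' = span {u - inverse b *\<^sub>R X u}"
    unfolding u(6,7) e using b by (simp_all only: span_scale_singleton neg_equal_0_iff_equal simp_thms)
  moreover have "\<nexists>k. X u = k *\<^sub>R u"
    using u(2) S \<open>u \<noteq> 0\<close> span_X_eq_iff[of u] unfolding v by (simp add: polar_point_S')
  ultimately show "corr Z Z'"
    unfolding corr_def using S0 b(1) nonzero_imp_inverse_nonzero by blast
next
  assume "corr Z Z'"
  then obtain u a where u: "a \<noteq> 0" "S u u = 0" "\<nexists>k. X u = k *\<^sub>R u"
     "Z = span {u + a *\<^sub>R X u}" "Z' = span {u - a *\<^sub>R X u}" 
    unfolding corr_def by auto
  have "u \<noteq> 0" using u(3) by (rule nonparallel_nonzero)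
  define v where "v = a *\<^sub>R X u"
  have S': "S' v v = 0" using u(2) by (simp add: v_def S'_X_X linear_scale[OF linear_S'] blinfun.bilinear_simps)
  have "v \<noteq> 0" using u \<open>u \<noteq> 0\<close> by (simp add: v_def)
  have vX: "v = X (a *\<^sub>R u)" by (simp add: v_def X_linear)
  have p: "polar_point \<omega> (quadric S') (span {v}) = span {u}"
    unfolding vX using polar_point_S'[of "a *\<^sub>R u"] u(1) \<open>u \<noteq> 0\<close> S'[unfolded vX] by (simp add: span_scale_singleton)
  have "span {v} = span {X u}"
    using u(1) by (simp add: v_def span_scale_singleton)
  then have "polar_point \<omega> (quadric S') (span {v}) \<noteq> span {v}"
    unfolding p using u(3) \<open>u \<noteq> 0\<close> span_X_eq_iff[of u] by simp
  moreover have "Z = span {v + u}" "Z' = span {v - u}"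
    using u(4,5) span_scale_singleton[of "-1" "v - u"] by (simp_all add: v_def add.commute)
  moreover have "span {v} \<in> quadric S'" using \<open>v \<noteq> 0\<close> S' by (simp add: mem_quadric_iff[OF linear_S'])
  ultimately show "outer_correspondence \<omega> (quadric S') Z Z'"
    unfolding outer_correspondence_def using p \<open>u \<noteq> 0\<close> \<open>v \<noteq> 0\<close> by blast
qed

lemmas S_linear = linear_add[OF linear_S] linear_diff[OF linear_S] linear_scale[OF linear_S]
  linear_neg[OF linear_S] linear_0[OF linear_S] blinfun.bilinear_simps
lemmas S'_linear = linear_add[OF linear_S'] linear_diff[OF linear_S'] linear_scale[OF linear_S']
  linear_neg[OF linear_S'] linear_0[OF linear_S'] blinfun.bilinear_simps

lemma S'_sym: "S' u v = S' v u"
  using symmetric_S' by (auto simp: symmetric_form_def)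

text \<open>These are the cross terms of \<open>S\<close> on \<open>u + a X u\<close>. Since they
  vanish, as do those of \<open>S'\<close> below, both forms depend on \<open>a\<close> only through
  its square and do not see the reflection \<open>a\<close> to \<open>- a\<close>.\<close>

lemma S_u_Xu [simp]: "S u (X u) = 0" "S (X u) u = 0"
  using S_sym[of "X u" u] by (simp_all add: S_omega)

lemma S'_u_Xu [simp]: "S' u (X u) = 0" "S' (X u) u = 0"
  using S'_sym[of "X u" u] by (simp_all add: S'_X blinfun.bilinear_simps)

text \<open>Pair \<open>cayley_hamilton\<close> at \<open>inv X u\<close> with \<open>u\<close>.
  This is how \<open>c\<close> and \<open>det X\<close> enter the pencil.\<close>

lemma S_X_X: "S (X u) (X u) = c * S u u - d * S' u u"
proof -
  have "\<omega> (X (X (X u)) + c *\<^sub>R X u + d *\<^sub>R inv X u) u = 0"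
    using cayley_hamilton[of "inv X u"] by (simp add: blinfun.bilinear_simps omega_linear)
  moreover have "\<omega> (X (X (X u))) u = - S (X u) (X u)"
    by (simp add: S_omega omega_X[of "X (X u)"])
  ultimately show ?thesis
    by (simp add: omega_bilinear S_omega S'_omega)
qed

text \<open>This is \<open>det (id + a X)\<close>, written out with the even characteristic
  polynomial.\<close>

definition p where "p a = 1 + a\<^sup>2 * c + a ^ 4 * d"

lemma p_minus [simp]: "p (- a) = p a"
  by (simp add: p_def)

lemma S_add_X: "S (u + a *\<^sub>R X u) (u + a *\<^sub>R X u) = S u u + a\<^sup>2 * S (X u) (X u)"
  by (simp add: S_linear power2_eq_square)

lemma S'_add_X: "S' (u + a *\<^sub>R X u) (u + a *\<^sub>R X u) = S' u u + a\<^sup>2 * S u u"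
  by (simp add: S'_linear S'_X_X power2_eq_square)

text \<open>The factor \<open>a^2 d\<close> of \<open>S'\<close> is the one for which the
  \<open>S' u u\<close> terms cancel, the other coming from \<open>S_X_X\<close>.\<close>

lemma pencil_add_X:
  "S (u + a *\<^sub>R X u) (u + a *\<^sub>R X u) + a\<^sup>2 * d * S' (u + a *\<^sub>R X u) (u + a *\<^sub>R X u) = p a * S u u"
  unfolding S_add_X S'_add_X S_X_X p_def by (simp add: algebra_simps power2_eq_square power4_eq_xxxx)

lemma S_reflect: "S (u - a *\<^sub>R X u) (u - a *\<^sub>R X u) = S (u + a *\<^sub>R X u) (u + a *\<^sub>R X u)"
  and S'_reflect: "S' (u - a *\<^sub>R X u) (u - a *\<^sub>R X u) = S' (u + a *\<^sub>R X u) (u + a *\<^sub>R X u)"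
  using S_add_X[of u a] S_add_X[of u "-a"] S'_add_X[of u a] S'_add_X[of u "-a"] by simp_all

text \<open>\<open>X - k\<close> is singular together with its \<open>\<omega>\<close>-adjoint \<open>- X - k\<close>.\<close>

lemma eigenvector_neg:
  assumes "v \<noteq> 0" "X v = k *\<^sub>R v"
  obtains w where "w \<noteq> 0" "X w = - k *\<^sub>R w"
proof (rule ccontr)
  assume *: "\<not> thesis"
  define T where "T w = X w + k *\<^sub>R w" for w
  have lin: "linear T"
    unfolding T_def by (intro linear_compose_add linear_X linear_scale_self)
  have "inj T"
    unfolding linear_injective_0[OF lin]
  proof (intro allI impI)
    fix w assume "T w = 0"
    then have "X w = - k *\<^sub>R w" by (simp add: T_def add_eq_0_iff)
    then show "w = 0" using * that by blast
  qed
  then have "surj T" using lin by (simp add: linear_injective_imp_surjective)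
  have "\<omega> v (T w) = 0" for w
    using omega_X[of v w] assms(2) by (simp add: T_def omega_bilinear)
  then have "\<omega> v y = 0" for y
    using \<open>surj T\<close> by (metis surj_def)
  then show False using assms(1) omega_nondegenerate by blast
qed

lemma eigenvector_imp_root:
  assumes "v \<noteq> 0" "X (X v) = t *\<^sub>R v"
  shows "t\<^sup>2 + c * t + d = 0"
proof -
  have "(t\<^sup>2 + c * t + d) *\<^sub>R v = 0"
    using cayley_hamilton[of v] assms(2) by (simp add: X_linear algebra_simps power2_eq_square)
  then show ?thesis using assms(1) by simp
qed

lemma p_root: "a \<noteq> 0 \<Longrightarrow> p a = a ^ 4 * ((1 / a\<^sup>2)\<^sup>2 + c * (1 / a\<^sup>2) + d)"
  by (simp add: p_def field_simps power2_eq_square power4_eq_xxxx)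

lemma is_eigenvalue_iff_p:
  assumes "a \<noteq> 0"
  shows "is_eigenvalue X (1 / a) \<longleftrightarrow> p a = 0"
proof
  assume "is_eigenvalue X (1 / a)"
  then obtain v where v: "v \<noteq> 0" "X v = (1 / a) *\<^sub>R v" by (auto simp: is_eigenvalue_def)
  then have "X (X v) = (1 / a\<^sup>2) *\<^sub>R v" by (simp add: X_linear power2_eq_square)
  from eigenvector_imp_root[OF v(1) this] show "p a = 0"
    using assms by (simp add: p_root)
next
  assume "p a = 0"
  then have "(1 / a\<^sup>2)\<^sup>2 + c * (1 / a\<^sup>2) + d = 0" using assms by (simp add: p_root)
  then obtain v where v: "v \<noteq> 0" "X (X v) = (1 / a\<^sup>2) *\<^sub>R v" by (rule char_root_eigenvector)
  \<comment> \<open>From the factorisation \<open>X^2 - 1/a^2 = (X - 1/a) (X + 1/a)\<close>. If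
    \<open>w\<close> vanishes, \<open>v\<close> belongs to \<open>- 1/a\<close>, and
    \<open>eigenvector_neg\<close> changes the sign.\<close>
  define w where "w = X v + (1 / a) *\<^sub>R v"
  have Xw: "X w = (1 / a) *\<^sub>R w"
    using v(2) assms by (simp add: w_def X_linear algebra_simps power2_eq_square)
  show "is_eigenvalue X (1 / a)"
  proof (cases "w = 0")
    case True
    then have "X v = (- (1 / a)) *\<^sub>R v" by (simp add: w_def add_eq_0_iff)
    from eigenvector_neg[OF v(1) this] obtain w where "w \<noteq> 0" "X w = (1 / a) *\<^sub>R w" by auto
    then show ?thesis by (auto simp: is_eigenvalue_def)
  qed (use Xw in \<open>auto simp: is_eigenvalue_def\<close>)
qed

lemma linear_add_X: "linear (\<lambda>v. v + a *\<^sub>R X v)"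
  by (intro linear_compose_add linear_compose_scale_right linear_X linear_id[unfolded id_def])

lemma bij_add_X:
  assumes "p a \<noteq> 0"
  shows "bij (\<lambda>v. v + a *\<^sub>R X v)"
proof -
  have "inj (\<lambda>v. v + a *\<^sub>R X v)"
    unfolding linear_injective_0[OF linear_add_X]
  proof (intro allI impI, rule ccontr)
    fix v assume v: "v + a *\<^sub>R X v = 0" "v \<noteq> 0"
    then have "a \<noteq> 0" by auto
    have "X v = (1 / (- a)) *\<^sub>R v"
      using v(1) \<open>a \<noteq> 0\<close> eq_scaleR_inverse_iff[of "- a" "X v" v] by (simp add: add_eq_0_iff)
    then have "is_eigenvalue X (1 / (- a))" using v(2) by (auto simp: is_eigenvalue_def)
    then show False using is_eigenvalue_iff_p[of "- a"] \<open>a \<noteq> 0\<close> assms by simp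
  qed
  then show ?thesis
    using linear_injective_imp_surjective[OF linear_add_X] by (simp add: bij_def)
qed

text \<open>The cofactor of \<open>id - a^2 X^2\<close> in the quadratic relation for
  \<open>X^2\<close>: their product is \<open>p a\<close> times the identity (\<open>XX_N\<close>).
  Up to the invertible \<open>\<omega> \<circ> X\<close>, \<open>N a z\<close> is also half the
  differential of the pencil form at \<open>z\<close> (\<open>pencil_N\<close>).\<close>

definition N where "N a z = (1 + a\<^sup>2 * c) *\<^sub>R z + a\<^sup>2 *\<^sub>R X (X z)"

lemma pencil_N: "S z + (a\<^sup>2 * d) *\<^sub>R S' z = \<omega> (X (N a z))"
proof -
  have *: "d *\<^sub>R inv X z = - (X (X (X z)) + c *\<^sub>R X z)"
    using cayley_hamilton[of "inv X z"] by (simp add: add_eq_0_iff)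
  have "d *\<^sub>R S' z = \<omega> (- (d *\<^sub>R inv X z))"
    by (simp add: S'_omega omega_linear)
  then have "d *\<^sub>R S' z = \<omega> (X (X (X z)) + c *\<^sub>R X z)"
    unfolding * by (simp only: minus_minus)
  then have "a\<^sup>2 *\<^sub>R d *\<^sub>R S' z = a\<^sup>2 *\<^sub>R \<omega> (X (X (X z)) + c *\<^sub>R X z)"
    by (rule arg_cong)
  then show ?thesis
    by (simp add: S_omega N_def X_linear omega_linear algebra_simps)
qed

lemma N_eq_0_iff:
  assumes "a \<noteq> 0"
  shows "N a z = 0 \<longleftrightarrow> X (X z) = (- (1 + a\<^sup>2 * c) / a\<^sup>2) *\<^sub>R z"
proof
  assume "N a z = 0"
  then have "a\<^sup>2 *\<^sub>R X (X z) = - ((1 + a\<^sup>2 * c) *\<^sub>R z)"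
    unfolding N_def by (simp only: eq_neg_iff_add_eq_0 add.commute)
  then have "a\<^sup>2 *\<^sub>R X (X z) = - (1 + a\<^sup>2 * c) *\<^sub>R z" by (simp only: scaleR_minus_left)
  then have "(1 / a\<^sup>2) *\<^sub>R (a\<^sup>2 *\<^sub>R X (X z)) = (1 / a\<^sup>2) *\<^sub>R (- (1 + a\<^sup>2 * c) *\<^sub>R z)" by (rule arg_cong)
  then show "X (X z) = (- (1 + a\<^sup>2 * c) / a\<^sup>2) *\<^sub>R z" using assms by simp
qed (use assms in \<open>simp add: N_def flip: scaleR_add_left\<close>)

text \<open>The argument is \<open>- c - 1/a^2\<close>. A quadratic \<open>t^2 + c t + d\<close>
  takes equal values at \<open>t\<close> and \<open>- c - t\<close>, so this is the value at
  \<open>1/a^2\<close> already seen in \<open>p_root\<close>; at a root it is the second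
  root.\<close>

lemma p_other_root: "a \<noteq> 0 \<Longrightarrow> (- (1 + a\<^sup>2 * c) / a\<^sup>2)\<^sup>2 + c * (- (1 + a\<^sup>2 * c) / a\<^sup>2) + d = p a / a ^ 4"
  by (simp add: p_def field_simps power2_eq_square power4_eq_xxxx)

lemma linear_N: "linear (N a)"
  unfolding N_def
  by (intro linear_compose_add linear_scale_self linear_compose_scale_right linear_compose[OF linear_X linear_X, unfolded o_def])

text \<open>By \<open>pencil_N\<close> the form is degenerate exactly when \<open>N a\<close> is,
  that is, when \<open>- c - 1/a^2\<close> is an eigenvalue of \<open>X^2\<close>.\<close>

lemma bij_pencil_iff:
  assumes "a \<noteq> 0"
  shows "bij (\<lambda>v. S v + (a\<^sup>2 * d) *\<^sub>R S' v) \<longleftrightarrow> p a \<noteq> 0"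
proof
  assume "bij (\<lambda>v. S v + (a\<^sup>2 * d) *\<^sub>R S' v)"
  then have inj: "inj (\<lambda>v. \<omega> (X (N a v)))" by (simp add: pencil_N bij_is_inj)
  show "p a \<noteq> 0"
  proof
    assume "p a = 0"
    then obtain v where "v \<noteq> 0" "X (X v) = (- (1 + a\<^sup>2 * c) / a\<^sup>2) *\<^sub>R v"
      using char_root_eigenvector p_other_root[OF assms] by (metis div_0)
    then have "N a v = 0" "v \<noteq> 0" by (simp_all add: N_eq_0_iff[OF assms])
    then show False
      using injD[OF inj, of v 0] by (simp add: linear_0[OF linear_N])
  qed
next
  assume p: "p a \<noteq> 0"
  have "inj (N a)"
    unfolding linear_injective_0[OF linear_N]
  proof (intro allI impI, rule ccontr)
    fix v assume "N a v = 0" "v \<noteq> 0"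
    then have "p a / a ^ 4 = 0"
      unfolding p_other_root[OF assms, symmetric]
      by (intro eigenvector_imp_root[of v]) (simp_all add: N_eq_0_iff[OF assms])
    then show False using p assms by simp
  qed
  then have "bij (N a)"
    using linear_injective_imp_surjective[OF linear_N] by (simp add: bij_def)
  then have "bij (\<omega> \<circ> (X \<circ> N a))"
    by (intro bij_comp bij_omega bij_X)
  then show "bij (\<lambda>v. S v + (a\<^sup>2 * d) *\<^sub>R S' v)"
    by (simp add: pencil_N o_def)
qed

text \<open>The range of \<open>id + a X\<close> is the \<open>\<omega>\<close>-complement of the kernel of its \<open>\<omega>\<close>-adjoint \<open>id - a X\<close>.\<close>

lemma mem_range_add_X:
  assumes "\<And>w. X w = (1 / a) *\<^sub>R w \<Longrightarrow> \<omega> z w = 0" "a \<noteq> 0"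
  obtains v where "z = v + a *\<^sub>R X v"
proof -
  define R where "R = range (\<lambda>v. v + a *\<^sub>R X v)"
  have sub: "subspace R"
    unfolding R_def by (rule linear_subspace_image[OF linear_add_X subspace_UNIV])
  \<comment> \<open>The Euclidean normal component \<open>g\<close> of \<open>z\<close> is turned
    into a vector \<open>w\<close> via \<open>\<omega>\<close>; this \<open>w\<close> lies in the
    kernel of \<open>id - a X\<close>, so the hypothesis makes \<open>g\<close> orthogonal to
    \<open>z\<close> and hence zero.\<close>
  obtain y g where yg: "y \<in> span R" "\<And>w. w \<in> span R \<Longrightarrow> orthogonal g w" "z = y + g"
    using orthogonal_subspace_decomp_exists[of R z] by blast
  obtain gg :: V_dual where gg: "\<And>v. gg v = g \<bullet> v"
    by (metis blinfun_inner_right.rep_eq)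
  obtain w where w: "\<omega> w = gg"
    using bij_omega by (metis bij_pointE)
  have "\<omega> (w - a *\<^sub>R X w) v = 0" for v
  proof -
    have "\<omega> (w - a *\<^sub>R X w) v = \<omega> w (v + a *\<^sub>R X v)"
      by (simp add: omega_bilinear omega_X)
    also have "\<dots> = 0"
      using yg(2)[of "v + a *\<^sub>R X v"] by (auto simp: w gg R_def orthogonal_def intro: span_base)
    finally show ?thesis .
  qed
  then have "w - a *\<^sub>R X w = 0" by (rule omega_nondegenerate)
  then have "X w = (1 / a) *\<^sub>R w"
    using eq_scaleR_inverse_iff[OF assms(2), of "X w" w] by simp
  then have "\<omega> w z = 0"
    using assms(1) omega_skew[of w z] by simp
  then have "g \<bullet> (y + g) = 0" by (simp add: w gg yg(3))
  moreover have "g \<bullet> y = 0" using yg(1,2) by (simp add: orthogonal_def)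
  ultimately have "z \<in> span R" using yg by (simp add: inner_add_right)
  then show ?thesis using that sub by (auto simp: R_def span_eq_iff[THEN iffD2])
qed

section \<open>Counting correspondents\<close>

text \<open>Consequently, off the base locus the condition that \<open>u\<close> and
  \<open>X u\<close> are not parallel is automatic.\<close>

lemma eigenvector_in_base:
  assumes "X z = k *\<^sub>R z"
  shows "S z z = 0" "S' z z = 0"
proof -
  show 0: "S z z = 0" by (simp add: S_omega assms omega_bilinear)
  show "S' z z = 0"
  proof (cases "k = 0")
    case True
    then show ?thesis using assms by (simp add: S'_linear)
  next
    case False
    have "k * k * S' z z = 0"
      using S'_X_X[of z z] 0 by (simp add: assms S'_linear)
    with False show ?thesis by simp
  qed
qed

text \<open>The correspondence for a fixed lift \<open>z\<close>: scaling is gone, and the partner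
  is the reflection \<open>2 u - z\<close>.\<close>

definition sol :: "V \<Rightarrow> real \<Rightarrow> V \<Rightarrow> bool" where
  "sol z a u \<longleftrightarrow> a \<noteq> 0 \<and> z = u + a *\<^sub>R X u \<and> S u u = 0 \<and> (\<nexists>k. X u = k *\<^sub>R u)"

lemma sol_reflect: "sol z a u \<Longrightarrow> u - a *\<^sub>R X u = 2 *\<^sub>R u - z"
  by (simp add: sol_def scaleR_2)

lemma sol_nonzero:
  assumes "sol z a u"
  shows "u \<noteq> 0" "z \<noteq> 0" "2 *\<^sub>R u - z \<noteq> 0"
proof -
  show "u \<noteq> 0" using assms by (auto simp: sol_def)
  have *: False if "u + b *\<^sub>R X u = 0" "b \<noteq> 0" for b
  proof -
    have "b *\<^sub>R X u = - 1 *\<^sub>R u" using that(1) by (simp add: add_eq_0_iff)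
    then have "X u = (1 / b) *\<^sub>R (- 1 *\<^sub>R u)" using eq_scaleR_inverse_iff[OF that(2)] by blast
    then have "X u = (- 1 / b) *\<^sub>R u" by simp
    then show False using assms unfolding sol_def by blast
  qed
  show "z \<noteq> 0" using *[of a] assms by (auto simp: sol_def)
  show "2 *\<^sub>R u - z \<noteq> 0" using *[of "- a"] assms unfolding sol_reflect[OF assms, symmetric]
    by (auto simp: sol_def)
qed

lemma sol_pencil:
  assumes "sol z a u"
  shows "S z z + a\<^sup>2 * d * S' z z = 0" "S' z z = S' u u"
  using assms pencil_add_X[of u a] S'_add_X[of u a] by (simp_all add: sol_def)

lemma sol_reflect_forms:
  assumes "sol z a u"
  shows "S (2 *\<^sub>R u - z) (2 *\<^sub>R u - z) = S z z" "S' (2 *\<^sub>R u - z) (2 *\<^sub>R u - z) = S' z z"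
  using assms S_reflect[of u a] S'_reflect[of u a] unfolding sol_reflect[OF assms, symmetric] by (simp_all add: sol_def)

lemma corr_iff_sol:
  assumes "z \<noteq> 0"
  shows "corr (span {z}) Z' \<longleftrightarrow> (\<exists>a u. sol z a u \<and> Z' = span {2 *\<^sub>R u - z})"
proof
  assume "corr (span {z}) Z'"
  then obtain u a where u: "a \<noteq> 0" "S u u = 0" "\<nexists>k. X u = k *\<^sub>R u"
     "span {z} = span {u + a *\<^sub>R X u}" "Z' = span {u - a *\<^sub>R X u}" 
    unfolding corr_def by auto
  obtain k where k: "k \<noteq> 0" "z = k *\<^sub>R (u + a *\<^sub>R X u)"
    using u(4)[symmetric] unfolding span_singleton_eq_iff by blast
  have "X (k *\<^sub>R u) \<noteq> l *\<^sub>R (k *\<^sub>R u)" for l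
  proof
    assume "X (k *\<^sub>R u) = l *\<^sub>R (k *\<^sub>R u)"
    then have "k *\<^sub>R X u = k *\<^sub>R (l *\<^sub>R u)" by (simp add: X_linear mult.commute)
    then have "X u = l *\<^sub>R u" using k(1) unfolding scaleR_cancel_left by blast
    then show False using u(3) by blast
  qed
  then have s: "sol z a (k *\<^sub>R u)"
    using u k by (simp add: sol_def X_linear S_linear algebra_simps)
  have "Z' = span {k *\<^sub>R u - a *\<^sub>R X (k *\<^sub>R u)}"
    using span_scale_singleton[OF k(1), of "u - a *\<^sub>R X u"] by (simp add: u(5) X_linear algebra_simps)
  then show "\<exists>a u. sol z a u \<and> Z' = span {2 *\<^sub>R u - z}"
    using s sol_reflect[OF s] by metis
next
  assume "\<exists>a u. sol z a u \<and> Z' = span {2 *\<^sub>R u - z}"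
  then obtain a u where s: "sol z a u" "Z' = span {2 *\<^sub>R u - z}" by blast
  then show "corr (span {z}) Z'"
    unfolding corr_def sol_reflect[OF s(1), symmetric] using s(1) unfolding sol_def by blast
qed

lemma infinite_corr:
  assumes "infinite T" "inj_on (\<lambda>t. span {2 *\<^sub>R u t - z}) T" "\<And>t. t \<in> T \<Longrightarrow> \<exists>a. sol z a (u t)"
  shows "infinite {Z'. corr (span {z}) Z'}"
proof
  assume "finite {Z'. corr (span {z}) Z'}"
  moreover have "(\<lambda>t. span {2 *\<^sub>R u t - z}) ` T \<subseteq> {Z'. corr (span {z}) Z'}"
  proof -
    have "corr (span {z}) (span {2 *\<^sub>R u t - z})" if t: "t \<in> T" for t
    proof -
      obtain a where "sol z a (u t)" using assms(3)[OF t] by blast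
      then show ?thesis using corr_iff_sol[OF sol_nonzero(2)] by blast
    qed
    then show ?thesis by blast
  qed
  ultimately have "finite ((\<lambda>t. span {2 *\<^sub>R u t - z}) ` T)" by (rule finite_subset[rotated])
  then show False using assms(1,2) finite_imageD by blast
qed

lemma parallel_add_X:
  assumes "z = u + a *\<^sub>R X u" "X u = k *\<^sub>R u"
  shows "z = (1 + a * k) *\<^sub>R u" "X z = k *\<^sub>R z"
  using assms by (simp_all add: algebra_simps X_linear)

text \<open>Moving \<open>u\<close> along the kernel vector \<open>y\<close> changes neither
  \<open>u + a X u\<close> nor \<open>S u u\<close>, since \<open>y\<close> is an eigenvector, hence
  isotropic, and \<open>S u y = 0\<close>. The condition on multiples makes the reflections
  \<open>2 u - z\<close> really move.\<close>

lemma infinite_corr_line: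
  assumes u: "sol z a u" and y: "y + a *\<^sub>R X y = 0" "S u y = 0" "\<And>k. y \<noteq> k *\<^sub>R (2 *\<^sub>R u - z)"
  shows "infinite {Z'. corr (span {z}) Z'}"
proof -
  let ?u = "\<lambda>t. u + t *\<^sub>R y"
  have a: "a \<noteq> 0" and z: "z = u + a *\<^sub>R X u" using u by (auto simp: sol_def)
  have "y \<noteq> 0" using y(3)[of 0] by simp
  have Xy: "X y = (1 / a) *\<^sub>R (- y)"
    using y(1) eq_scaleR_inverse_iff[OF a, of "X y" "- y"] by (simp add: add_eq_0_iff)
  have "S y y = 0" by (simp add: S_omega Xy omega_bilinear)
  then have Su: "S (?u t) (?u t) = 0" for t
    using u y(2) S_sym[of y u] by (simp add: sol_def S_linear)
  have zt: "z = ?u t + a *\<^sub>R X (?u t)" for t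
  proof -
    have "?u t + a *\<^sub>R X (?u t) = (u + a *\<^sub>R X u) + t *\<^sub>R (y + a *\<^sub>R X y)"
      by (simp add: X_linear algebra_simps)
    then show ?thesis by (simp add: y(1) z)
  qed
  define T where "T = {t. \<nexists>k. X (?u t) = k *\<^sub>R ?u t}"
  \<comment> \<open>Parallelism at \<open>s\<close> and at \<open>t\<close> makes \<open>z\<close>
    an eigenvector for both factors, so these agree and both points are the same multiple of
    \<open>z\<close>. At most one parameter is lost.\<close>
  have unique: "s = t" if st: "s \<notin> T" "t \<notin> T" for s t
  proof -
    obtain k l where k: "X (?u s) = k *\<^sub>R ?u s" "X (?u t) = l *\<^sub>R ?u t" using st unfolding T_def by blast
    note ps = parallel_add_X[OF zt k(1)] and pt = parallel_add_X[OF zt k(2)]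
    have "z \<noteq> 0" using sol_nonzero[OF u] by simp
    then have "k = l" using ps(2) pt(2) by simp
    then have "(1 + a * k) *\<^sub>R ?u s = (1 + a * k) *\<^sub>R ?u t" "1 + a * k \<noteq> 0"
      using ps(1) pt(1) \<open>z \<noteq> 0\<close> by auto
    then have "?u s = ?u t" by simp
    then show "s = t" using \<open>y \<noteq> 0\<close> by simp
  qed
  have "finite (- T)"
  proof (cases "- T = {}")
    case False
    then obtain t where "t \<in> - T" by blast
    then have "- T \<subseteq> {t}" using unique by blast
    then show ?thesis by (rule finite_subset) simp
  qed simp
  then have "infinite T"
    using infinite_UNIV_char_0[where ?'a = real] finite_compl by blast
  moreover have "inj_on (\<lambda>t. span {2 *\<^sub>R ?u t - z}) T"
  proof (rule inj_onI)
    fix s t assume *: "span {2 *\<^sub>R ?u s - z} = span {2 *\<^sub>R ?u t - z}"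
    have e: "2 *\<^sub>R ?u t - z = 1 *\<^sub>R (2 *\<^sub>R u - z) + (2 * t) *\<^sub>R y" for t
      by (simp add: algebra_simps)
    have "lin_indep2 (2 *\<^sub>R u - z) y"
      using sol_nonzero(3)[OF u] y(3) by (rule lin_indep2I)
    from lin_indep2_span_eq[OF this *[unfolded e]] show "s = t" by simp
  qed
  moreover have "\<exists>a. sol z a (?u t)" if "t \<in> T" for t
    using that a zt Su unfolding T_def sol_def by blast
  ultimately show ?thesis by (rule infinite_corr)
qed

text \<open>The difference \<open>u2 - u1\<close> is in the kernel of \<open>id + a X\<close>, hence
  isotropic; as \<open>u1\<close> and \<open>u2\<close> are isotropic too, polarisation gives
  \<open>S u1 u2 = 0\<close>.\<close>

lemma infinite_corr_same:
  assumes u: "sol z a u1" "sol z a u2" "span {2 *\<^sub>R u1 - z} \<noteq> span {2 *\<^sub>R u2 - z}"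
  shows "infinite {Z'. corr (span {z}) Z'}"
proof (rule infinite_corr_line[OF u(1)])
  define y where "y = u2 - u1"
  have a: "a \<noteq> 0" using u by (auto simp: sol_def)
  have z: "z = u1 + a *\<^sub>R X u1" "z = u2 + a *\<^sub>R X u2" using u by (auto simp: sol_def)
  have "y + a *\<^sub>R X y = (u2 + a *\<^sub>R X u2) - (u1 + a *\<^sub>R X u1)"
    by (simp add: y_def X_linear algebra_simps)
  then show y: "u2 - u1 + a *\<^sub>R X (u2 - u1) = 0" by (simp add: z[symmetric] y_def)
  have Xy: "X y = (1 / a) *\<^sub>R (- y)"
    using y eq_scaleR_inverse_iff[OF a, of "X y" "- y"] by (simp add: add_eq_0_iff y_def[symmetric])
  have "S y y = 0" by (simp add: S_omega Xy omega_bilinear)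
  moreover have "S u1 u1 = 0" "S u2 u2 = 0" using u by (auto simp: sol_def)
  ultimately have "S u1 u2 = 0" using S_sym[of u2 u1] by (simp add: y_def S_linear)
  then show "S u1 (u2 - u1) = 0" using \<open>S u1 u1 = 0\<close> by (simp add: S_linear)
  show "u2 - u1 \<noteq> k *\<^sub>R (2 *\<^sub>R u1 - z)" for k
  proof
    assume "u2 - u1 = k *\<^sub>R (2 *\<^sub>R u1 - z)"
    then have "2 *\<^sub>R (u2 - u1) = 2 *\<^sub>R (k *\<^sub>R (2 *\<^sub>R u1 - z))" by (rule arg_cong)
    then have e: "2 *\<^sub>R u2 - z = (1 + 2 * k) *\<^sub>R (2 *\<^sub>R u1 - z)"
      by (simp add: algebra_simps)
    then have "1 + 2 * k \<noteq> 0" using sol_nonzero(3)[OF u(2)] by auto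
    with e show False using u(3) span_scale_singleton by metis
  qed
qed

text \<open>For \<open>y\<close> in the kernel of \<open>id + a X\<close>, the representation by
  \<open>u2\<close> gives \<open>\<omega> z y = 0\<close> and the one by \<open>u1\<close> gives
  \<open>\<omega> z y = 2 \<omega> u1 y\<close>. Hence \<open>S u1 y = 0\<close>, as the line
  argument requires.\<close>

lemma infinite_corr_opposite:
  assumes u: "sol z a u1" "sol z (- a) u2" and p: "p a = 0" and z: "\<nexists>k. X z = k *\<^sub>R z"
  shows "infinite {Z'. corr (span {z}) Z'}"
proof -
  have a: "a \<noteq> 0" and z1: "z = u1 + a *\<^sub>R X u1" and z2: "z = u2 - a *\<^sub>R X u2" using u by (auto simp: sol_def)
  obtain y where y: "y \<noteq> 0" "X y = (1 / - a) *\<^sub>R y"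
    using is_eigenvalue_iff_p[of "- a"] a p unfolding is_eigenvalue_def by auto
  have Xy: "a *\<^sub>R X y = - y" using y(2) a by simp
  have "\<omega> z y = \<omega> u2 y + \<omega> u2 (a *\<^sub>R X y)"
    unfolding z2 by (simp add: omega_bilinear omega_X)
  then have "\<omega> z y = 0" unfolding Xy by (simp add: omega_bilinear)
  moreover have "\<omega> z y = \<omega> u1 y - \<omega> u1 (a *\<^sub>R X y)"
    unfolding z1 by (simp add: omega_bilinear omega_X)
  then have "\<omega> z y = 2 * \<omega> u1 y" unfolding Xy by (simp add: omega_bilinear)
  ultimately have "\<omega> u1 y = 0" by simp
  then have "S u1 y = 0" unfolding S_omega omega_X by (simp add: y(2) omega_bilinear)
  \<comment> \<open>Otherwise \<open>id + a X\<close> would kill \<open>2 u1 - z\<close>, but it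
    maps that vector to \<open>z - a X z\<close>, and \<open>z\<close> is no eigenvector.\<close>
  moreover have "y \<noteq> k *\<^sub>R (2 *\<^sub>R u1 - z)" for k
  proof
    assume k: "y = k *\<^sub>R (2 *\<^sub>R u1 - z)"
    then have "k \<noteq> 0" using y(1) by auto
    have "k *\<^sub>R ((2 *\<^sub>R u1 - z) + a *\<^sub>R X (2 *\<^sub>R u1 - z)) = y + a *\<^sub>R X y"
      by (simp add: k X_linear algebra_simps)
    then have "(2 *\<^sub>R u1 - z) + a *\<^sub>R X (2 *\<^sub>R u1 - z) = 0" using Xy \<open>k \<noteq> 0\<close> by simp
    moreover have "(2 *\<^sub>R u1 - z) + a *\<^sub>R X (2 *\<^sub>R u1 - z) = 2 *\<^sub>R (u1 + a *\<^sub>R X u1) - z - a *\<^sub>R X z"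
      by (simp add: X_linear algebra_simps)
    ultimately have "a *\<^sub>R X z = z" by (simp add: z1[symmetric] scaleR_2)
    then have "X z = (1 / a) *\<^sub>R z" using eq_scaleR_inverse_iff[OF a] by blast
    then show False using z by blast
  qed
  ultimately show ?thesis
    using Xy by (intro infinite_corr_line[OF u(1), of y]) simp_all
qed

text \<open>Here \<open>S u z = S z z = 0\<close>, so \<open>u\<close> may be moved inside the plane
  of \<open>u\<close> and \<open>z\<close>. For \<open>a * l = 1\<close> all these positions would
  have the same reflection, which is why that value is excluded.\<close>

lemma infinite_corr_eigenvector:
  assumes u: "sol z a u" and z: "X z = l *\<^sub>R z" and l: "a * l \<noteq> 1"
  shows "infinite {Z'. corr (span {z}) Z'}"
proof -
  have a: "a \<noteq> 0" and zu: "z = u + a *\<^sub>R X u" and Su: "S u u = 0" and nu: "\<nexists>k. X u = k *\<^sub>R u"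
    using u by (auto simp: sol_def)
  define m where "m = 1 + a * l"
  \<comment> \<open>Normalised so that \<open>v t + a X (v t) = z\<close>, because
    \<open>id + a X\<close> maps \<open>u\<close> to \<open>z\<close> and \<open>z\<close> to
    \<open>m z\<close>.\<close>
  define s where "s t = 1 - t * m" for t
  define v where "v t = s t *\<^sub>R u + t *\<^sub>R z" for t
  have indep: "lin_indep2 u z"
  proof (rule lin_indep2I)
    show "u \<noteq> 0" using sol_nonzero[OF u] by simp
    show "z \<noteq> k *\<^sub>R u" for k
    proof
      assume "z = k *\<^sub>R u"
      then have "a *\<^sub>R X u = (k - 1) *\<^sub>R u" using zu by (simp add: algebra_simps)
      then have "X u = (1 / a) *\<^sub>R ((k - 1) *\<^sub>R u)" using eq_scaleR_inverse_iff[OF a] by blast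
      then have "X u = ((k - 1) / a) *\<^sub>R u" by simp
      then show False using nu by blast
    qed
  qed
  have zv: "z = v t + a *\<^sub>R X (v t)" for t
  proof -
    have "v t + a *\<^sub>R X (v t) = s t *\<^sub>R (u + a *\<^sub>R X u) + t *\<^sub>R (z + a *\<^sub>R X z)"
      by (simp add: v_def X_linear algebra_simps)
    also have "\<dots> = (s t + t * m) *\<^sub>R z" unfolding zu[symmetric] z by (simp add: m_def algebra_simps)
    finally show ?thesis by (simp add: s_def)
  qed
  have "S u z = 0" using Su by (simp add: zu S_linear)
  then have Sv: "S (v t) (v t) = 0" for t
    using Su S_sym[of z u] eigenvector_in_base(1)[OF z] by (simp add: v_def S_linear)
  have nv: "X (v t) \<noteq> k *\<^sub>R v t" if "s t \<noteq> 0" for t k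
  proof
    assume "X (v t) = k *\<^sub>R v t"
    from parallel_add_X(1)[OF zv this] have "z = (1 + a * k) *\<^sub>R v t" .
    then have "((1 + a * k) * s t) *\<^sub>R u + ((1 + a * k) * t - 1) *\<^sub>R z = 0"
      by (simp add: v_def algebra_simps)
    then have "(1 + a * k) * s t = 0 \<and> (1 + a * k) * t - 1 = 0"
      using indep unfolding lin_indep2_def by blast
    then show False using that by auto
  qed
  have "infinite {t. s t \<noteq> 0}"
  proof -
    have "- {t. s t \<noteq> 0} \<subseteq> {1 / m}" by (auto simp: s_def eq_divide_eq split: if_splits)
    then have "finite (- {t. s t \<noteq> 0})" by (rule finite_subset) simp
    then show ?thesis using infinite_UNIV_char_0[where ?'a = real] finite_compl by blast
  qed
  moreover have "inj_on (\<lambda>t. span {2 *\<^sub>R v t - z}) {t. s t \<noteq> 0}"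
  proof (rule inj_onI)
    fix t t' assume *: "span {2 *\<^sub>R v t - z} = span {2 *\<^sub>R v t' - z}"
    have e: "2 *\<^sub>R v t - z = (2 * s t) *\<^sub>R u + (2 * t - 1) *\<^sub>R z" for t
      by (simp add: v_def algebra_simps)
    have "(t' - t) * (2 - m) = 0"
      using lin_indep2_span_eq[OF indep *[unfolded e]] by (simp add: s_def algebra_simps)
    then show "t = t'" using l by (simp add: m_def)
  qed
  moreover have "\<exists>a. sol z a (v t)" if "t \<in> {t. s t \<noteq> 0}" for t
    using that a zv Sv nv unfolding sol_def by blast
  ultimately show ?thesis by (rule infinite_corr)
qed


section \<open>The Cayley transform\<close>

definition resolvent :: "real \<Rightarrow> V \<Rightarrow> V" where
  "resolvent a z = inv (\<lambda>v. v + a *\<^sub>R X v) z"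

lemma resolvent:
  assumes "p a \<noteq> 0"
  shows "resolvent a z + a *\<^sub>R X (resolvent a z) = z"
  unfolding resolvent_def using surj_f_inv_f[OF bij_is_surj[OF bij_add_X[OF assms]]] .

lemma resolvent_unique:
  assumes "p a \<noteq> 0" "z = u + a *\<^sub>R X u"
  shows "u = resolvent a z"
  unfolding resolvent_def assms(2) by (rule inv_f_f[OF bij_is_inj[OF bij_add_X[OF assms(1)]], symmetric])

lemma cayley_resolvent:
  assumes "p a \<noteq> 0"
  shows "cayley X a z = 2 *\<^sub>R resolvent a z - z"
proof -
  have "cayley X a z = resolvent a z - a *\<^sub>R X (resolvent a z)"
    by (simp add: cayley_def resolvent_def)
  also have "\<dots> = 2 *\<^sub>R resolvent a z - (resolvent a z + a *\<^sub>R X (resolvent a z))"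
    by (simp add: scaleR_2)
  finally show ?thesis by (simp add: resolvent[OF assms])
qed

lemma resolvent_eq_imp_parallel:
  assumes "p a \<noteq> 0" "X (resolvent a z) = k *\<^sub>R resolvent a z"
  shows "X z = k *\<^sub>R z"
  using parallel_add_X(2)[OF resolvent[OF assms(1), symmetric] assms(2)] .

lemma sol_resolvent:
  assumes "p a \<noteq> 0" "a \<noteq> 0" "S z z + a\<^sup>2 * d * S' z z = 0" "\<nexists>k. X z = k *\<^sub>R z"
  shows "sol z a (resolvent a z)"
proof -
  have "p a * S (resolvent a z) (resolvent a z) = 0"
    using pencil_add_X[of "resolvent a z" a] assms(3) by (simp add: resolvent[OF assms(1)])
  then have "S (resolvent a z) (resolvent a z) = 0" using assms(1) by simp
  moreover have "\<nexists>k. X (resolvent a z) = k *\<^sub>R resolvent a z"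
    using assms(4) resolvent_eq_imp_parallel[OF assms(1)] by blast
  ultimately show ?thesis
    unfolding sol_def using assms(2) resolvent[OF assms(1), of z, symmetric] by blast
qed

lemma cayley_minus_cayley:
  assumes "p a \<noteq> 0"
  shows "cayley X (- a) (cayley X a z) = z"
proof -
  have pm: "p (- a) \<noteq> 0" using assms by simp
  have "cayley X a z = resolvent a z + (- a) *\<^sub>R X (resolvent a z)"
    by (simp add: cayley_def resolvent_def)
  then have e: "resolvent (- a) (cayley X a z) = resolvent a z"
    using resolvent_unique[OF pm] by metis
  show ?thesis
    unfolding cayley_resolvent[OF pm] e unfolding cayley_resolvent[OF assms] by simp
qed

lemma linear_cayley: 
  assumes "p a \<noteq> 0"
  shows "linear (cayley X a)"
proof -
  have "linear (resolvent a)"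
    unfolding resolvent_def[abs_def]
    by (rule inj_linear_imp_inv_linear[OF linear_add_X bij_is_inj[OF bij_add_X[OF assms]]])
  then have "linear (\<lambda>z. 2 *\<^sub>R resolvent a z - z)"
    by (intro linear_compose_sub linear_compose_scale_right linear_id[unfolded id_def])
  then show ?thesis using cayley_resolvent[OF assms] by (simp add: linear_iff)
qed

lemma cayley_eq_0_iff:
  assumes "p a \<noteq> 0"
  shows "cayley X a z = 0 \<longleftrightarrow> z = 0"
  using cayley_minus_cayley[OF assms, of z] linear_0[OF linear_cayley[OF assms]]
    linear_0[OF linear_cayley[of "- a"]] assms by auto

lemma cayley_forms:
  assumes "p a \<noteq> 0"
  shows "S (cayley X a z) (cayley X a z) = S z z" "S' (cayley X a z) (cayley X a z) = S' z z"
proof -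
  have *: "cayley X a z = resolvent a z - a *\<^sub>R X (resolvent a z)" by (simp add: cayley_def resolvent_def)
  show "S (cayley X a z) (cayley X a z) = S z z" "S' (cayley X a z) (cayley X a z) = S' z z"
    unfolding * S_reflect S'_reflect resolvent[OF assms] by (rule refl)+
qed

text \<open>Clearing denominators gives
  \<open>(id + a X) (id - b X) z = k (id + b X) (id - a X) z\<close>. Its terms are compared after
  ruling out \<open>k = 1\<close>, which would force \<open>(a - b) X z = 0\<close>.\<close>

lemma cayley_span_eq:
  assumes p: "p a \<noteq> 0" "p b \<noteq> 0" and ab: "a \<noteq> b" and z: "z \<noteq> 0"
    and eq: "span {cayley X a z} = span {cayley X b z}"
  obtains m where "(a * b) *\<^sub>R X (X z) = z + m *\<^sub>R X z"
proof -
  obtain k where k: "k \<noteq> 0" "cayley X b z = k *\<^sub>R cayley X a z"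
    using eq unfolding span_singleton_eq_iff by blast
  define T where "T a v = v + a *\<^sub>R X v" for a :: real and v
  have T_lin: "T a (x - y) = T a x - T a y" "T a (k *\<^sub>R x) = k *\<^sub>R T a x" for a x y k
    by (simp_all add: T_def X_linear algebra_simps)
  have T_comm: "T a (T b v) = T b (T a v)" for a b v
    by (simp add: T_def X_linear algebra_simps)
  have Tc: "T a (cayley X a z) = z - a *\<^sub>R X z" if "p a \<noteq> 0" for a
  proof -
    have "T a (resolvent a z) = z" unfolding T_def by (rule resolvent[OF that])
    then show ?thesis unfolding cayley_resolvent[OF that] T_lin by (simp add: T_def scaleR_2)
  qed
  have "T a (T b (cayley X b z)) = k *\<^sub>R T b (T a (cayley X a z))"
    unfolding k(2) T_lin T_comm[of a b] ..
  then have e: "T a (z - b *\<^sub>R X z) = k *\<^sub>R T b (z - a *\<^sub>R X z)"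
    by (simp only: Tc[OF p(1)] Tc[OF p(2)])
  then have e: "(a * b) *\<^sub>R ((1 - k) *\<^sub>R X (X z)) = (1 - k) *\<^sub>R z + ((a - b) * (1 + k)) *\<^sub>R X z"
    by (simp add: T_def X_linear algebra_simps)
  have "k \<noteq> 1"
  proof
    assume "k = 1"
    then have "((a - b) * 2) *\<^sub>R X z = 0" using e by simp
    then show False using ab z by simp
  qed
  have "(1 / (1 - k)) *\<^sub>R ((a * b) *\<^sub>R ((1 - k) *\<^sub>R X (X z))) =
    (1 / (1 - k)) *\<^sub>R ((1 - k) *\<^sub>R z + ((a - b) * (1 + k)) *\<^sub>R X z)"
    by (simp only: e)
  then have "(a * b) *\<^sub>R X (X z) = z + ((a - b) * (1 + k) / (1 - k)) *\<^sub>R X z"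
    using \<open>k \<noteq> 1\<close> by (simp add: scaleR_add_right)
  then show ?thesis by (rule that)
qed

lemma p_nonzero_near_0: "\<exists>e>0. \<forall>a. 0 < a \<and> a < e \<longrightarrow> p a \<noteq> 0"
proof -
  have "isCont p 0" unfolding p_def by (intro continuous_intros)
  moreover have "p 0 = 1" by (simp add: p_def)
  ultimately have "\<forall>\<^sub>F a in at 0. p a \<noteq> 0"
    using tendsto_imp_eventually_ne[of p 1 "at 0" 0] by (simp add: isCont_def)
  then show ?thesis unfolding eventually_at by (auto simp: dist_real_def)
qed

text \<open>A base point satisfies the pencil equation for every \<open>a\<close>, so each small
  \<open>a\<close> yields a correspondent; it remains to keep these distinct.\<close>

lemma infinite_corr_base:
  assumes z: "z \<noteq> 0" "S z z = 0" "S' z z = 0" "\<nexists>k. X z = k *\<^sub>R z"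
  shows "infinite {Z'. corr (span {z}) Z'}"
proof -
  obtain e where e: "e > 0" "\<And>a. 0 < a \<Longrightarrow> a < e \<Longrightarrow> p a \<noteq> 0"
    using p_nonzero_near_0 by blast
  have indep: "lin_indep2 z (X z)"
    using z by (intro lin_indep2I) auto
  \<comment> \<open>A coincidence for \<open>a\<close> and \<open>b\<close> is such a relation with
    \<open>s = a * b\<close>. Independence of \<open>z\<close> and \<open>X z\<close> allows at most
    one positive \<open>s\<close>, so small parameters have no coincidences.\<close>
  have "\<exists>r>0. \<forall>s m. 0 < s \<and> s < r \<longrightarrow> s *\<^sub>R X (X z) \<noteq> z + m *\<^sub>R X z"
  proof (cases "\<exists>r m. 0 < r \<and> r *\<^sub>R X (X z) = z + m *\<^sub>R X z")
    case True
    then obtain r m where r: "0 < r" "r *\<^sub>R X (X z) = z + m *\<^sub>R X z" by blast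
    have "r = s" if s: "s *\<^sub>R X (X z) = z + l *\<^sub>R X z" for s l
    proof -
      have "s *\<^sub>R (z + m *\<^sub>R X z) = r *\<^sub>R (z + l *\<^sub>R X z)"
        unfolding s[symmetric] r(2)[symmetric] by simp
      then have "(r - s) *\<^sub>R z + (r * l - s * m) *\<^sub>R X z = 0"
        by (simp add: algebra_simps)
      then have "r - s = 0" using indep unfolding lin_indep2_def by blast
      then show ?thesis by simp
    qed
    then show ?thesis using r(1) by blast
  next
    case False
    then show ?thesis using zero_less_one by blast
  qed
  then obtain r where r: "r > 0" "\<And>s m. 0 < s \<Longrightarrow> s < r \<Longrightarrow> s *\<^sub>R X (X z) \<noteq> z + m *\<^sub>R X z"
    by blast
  define h where "h = min e (min 1 r)"
  have h: "0 < h" "h \<le> e" "h \<le> 1" "h \<le> r" using e r by (auto simp: h_def)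
  have "infinite {0<..<h}" using h(1) by (rule infinite_Ioo)
  moreover have "inj_on (\<lambda>a. span {2 *\<^sub>R resolvent a z - z}) {0<..<h}"
  proof (rule inj_onI, rule ccontr)
    fix a b assume ab: "a \<in> {0<..<h}" "b \<in> {0<..<h}" "a \<noteq> b"
      and eq: "span {2 *\<^sub>R resolvent a z - z} = span {2 *\<^sub>R resolvent b z - z}"
    have p: "p a \<noteq> 0" "p b \<noteq> 0" using e(2) ab h by auto
    obtain m where m: "(a * b) *\<^sub>R X (X z) = z + m *\<^sub>R X z"
      using cayley_span_eq[OF p ab(3) z(1)] eq by (auto simp: cayley_resolvent p)
    have "a * b < r" 
    proof -
      have "a * b \<le> a * 1" using ab h by (intro mult_left_mono) auto
      also have "\<dots> < r" using ab h by auto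
      finally show ?thesis .
    qed
    moreover have "0 < a * b" using ab by simp
    ultimately show False using r(2) m by blast
  qed
  moreover have "\<exists>b. sol z b (resolvent a z)" if "a \<in> {0<..<h}" for a
    using sol_resolvent[of a z] e(2)[of a] h that z by auto
  ultimately show ?thesis by (rule infinite_corr)
qed

lemma pencil_parameter_unique:
  assumes "S z z + b\<^sup>2 * d * S' z z = 0" "S z z + a\<^sup>2 * d * S' z z = 0" "S' z z \<noteq> 0"
  shows "b\<^sup>2 = a\<^sup>2"
proof -
  have "(b\<^sup>2 - a\<^sup>2) * (d * S' z z) = (S z z + b\<^sup>2 * d * S' z z) - (S z z + a\<^sup>2 * d * S' z z)"
    by (simp add: algebra_simps)
  then have "(b\<^sup>2 - a\<^sup>2) * (d * S' z z) = 0" by (simp only: assms(1,2) diff_self)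
  then show ?thesis using d_nonzero assms(3) by simp
qed

lemma corr_nonexceptional:
  assumes z: "z \<noteq> 0" "\<not> (S z z = 0 \<and> S' z z = 0)"
    and a: "a \<noteq> 0" "p a \<noteq> 0" "S z z + a\<^sup>2 * d * S' z z = 0"
  shows "{Z'. corr (span {z}) Z'} = {span {cayley X a z}, span {cayley X (- a) z}}"
    and "span {cayley X a z} \<noteq> span {cayley X (- a) z}"
proof -
  have S'z: "S' z z \<noteq> 0" using z(2) a(3) by auto
  have ne: "\<nexists>k. X z = k *\<^sub>R z" using eigenvector_in_base z(2) by blast
  have pm: "p (- a) \<noteq> 0" using a(2) by simp
  have sols: "sol z a (resolvent a z)" "sol z (- a) (resolvent (- a) z)"
    using sol_resolvent[OF a(2,1,3) ne] sol_resolvent[OF pm, of z] a ne by auto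
  show "{Z'. corr (span {z}) Z'} = {span {cayley X a z}, span {cayley X (- a) z}}"
  proof
    show "{span {cayley X a z}, span {cayley X (- a) z}} \<subseteq> {Z'. corr (span {z}) Z'}"
      using sols unfolding cayley_resolvent[OF a(2)] cayley_resolvent[OF pm] corr_iff_sol[OF z(1)] by blast
    show "{Z'. corr (span {z}) Z'} \<subseteq> {span {cayley X a z}, span {cayley X (- a) z}}"
    proof
      fix Z' assume "Z' \<in> {Z'. corr (span {z}) Z'}"
      then obtain b u where u: "sol z b u" "Z' = span {2 *\<^sub>R u - z}"
        using corr_iff_sol[OF z(1)] by auto
      have "b\<^sup>2 = a\<^sup>2" using pencil_parameter_unique[OF sol_pencil(1)[OF u(1)] a(3) S'z] .
      then have "b = a \<or> b = - a" by (simp add: power2_eq_iff)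
      then show "Z' \<in> {span {cayley X a z}, span {cayley X (- a) z}}"
        using u resolvent_unique[of b z u] a(2) pm unfolding cayley_resolvent[OF a(2)] cayley_resolvent[OF pm]
        by (auto simp: sol_def)
    qed
  qed
  show "span {cayley X a z} \<noteq> span {cayley X (- a) z}"
  proof
    assume "span {cayley X a z} = span {cayley X (- a) z}"
    then obtain m where m: "(a * - a) *\<^sub>R X (X z) = z + m *\<^sub>R X z"
      using cayley_span_eq[OF a(2) pm _ z(1)] a(1) by auto
    \<comment> \<open>Pairing the relation with \<open>z\<close> gives \<open>m S z z = 0\<close>;
      pairing it with \<open>X z\<close> and using the pencil equation gives
      \<open>a^2 c S z z = 0\<close>. So \<open>c = m = 0\<close> and
      \<open>X^2 z = - z / a^2\<close>, which makes \<open>p a\<close> vanish.\<close>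
    have XXz: "\<omega> (X (X z)) z = 0" by (simp add: omega_X)
    have "\<omega> ((a * - a) *\<^sub>R X (X z)) z = \<omega> (z + m *\<^sub>R X z) z" by (simp only: m)
    then have mS: "m * S z z = 0" using XXz by (simp add: omega_bilinear S_omega)
    have "\<omega> ((a * - a) *\<^sub>R X (X z)) (X z) = \<omega> (z + m *\<^sub>R X z) (X z)" by (simp only: m)
    then have "a\<^sup>2 * S (X z) (X z) = S z z"
      by (simp add: omega_bilinear S_omega omega_X[of z z] power2_eq_square)
    then have "a\<^sup>2 * c * S z z - a\<^sup>2 * d * S' z z = S z z"
      by (simp add: S_X_X algebra_simps)
    then have "a\<^sup>2 * c * S z z = 0" using a(3) by linarith
    moreover have "S z z \<noteq> 0" using a(1,3) S'z d_nonzero by auto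
    ultimately have c0: "c = 0" and "m = 0" using mS a(1) by auto
    then have "(a * - a) *\<^sub>R X (X z) = z" using m by simp
    then have "X (X z) = (1 / (a * - a)) *\<^sub>R z"
      using eq_scaleR_inverse_iff[of "a * - a" "X (X z)" z] a(1) by simp
    from eigenvector_imp_root[OF z(1) this] have "(1 / (a * - a))\<^sup>2 + d = 0" by (simp add: c0)
    then have "p a = 0"
      using a(1) by (simp add: p_def c0 field_simps power2_eq_square power4_eq_xxxx)
    then show False using a(2) by simp
  qed
qed

lemma card_corr_2:
  assumes z: "z \<noteq> 0" and card: "card {Z'. corr (span {z}) Z'} = 2"
  obtains a where "a > 0" "p a \<noteq> 0" "S z z + a\<^sup>2 * d * S' z z = 0" "\<not> (S z z = 0 \<and> S' z z = 0)"
proof -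
  have fin: "finite {Z'. corr (span {z}) Z'}" using card by (metis card.infinite zero_neq_numeral)
  obtain Z1 Z2 where Z12: "corr (span {z}) Z1" "corr (span {z}) Z2" "Z1 \<noteq> Z2"
    using card by (auto simp: card_2_iff)
  obtain a1 u1 where u1: "sol z a1 u1" "Z1 = span {2 *\<^sub>R u1 - z}"
    using Z12(1) unfolding corr_iff_sol[OF z] by blast
  obtain a2 u2 where u2: "sol z a2 u2" "Z2 = span {2 *\<^sub>R u2 - z}"
    using Z12(2) unfolding corr_iff_sol[OF z] by blast
  have a: "a1 \<noteq> 0" using u1(1) by (simp add: sol_def)
  have ne: "a1 \<noteq> a2"
    using infinite_corr_same u1 u2 Z12(3) fin by blast
  have noneig: "\<nexists>k. X z = k *\<^sub>R z"
  proof
    assume "\<exists>k. X z = k *\<^sub>R z"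
    then obtain k where k: "X z = k *\<^sub>R z" by blast
    \<comment> \<open>The only case not covered by an infinite family, but it would force
      \<open>a1 = a2\<close>.\<close>
    have "a1 * k = 1" "a2 * k = 1"
      using infinite_corr_eigenvector[OF _ k] u1(1) u2(1) fin by blast+
    then have "(a1 - a2) * k = 0" by (simp add: algebra_simps)
    then show False using ne \<open>a1 * k = 1\<close> by auto
  qed
  have nonbase: "\<not> (S z z = 0 \<and> S' z z = 0)"
    using infinite_corr_base[OF z _ _ noneig] fin by blast
  have S'z: "S' z z \<noteq> 0" using nonbase sol_pencil(1)[OF u1(1)] by auto
  have "p a1 \<noteq> 0"
  proof
    assume p: "p a1 = 0"
    have "a2\<^sup>2 = a1\<^sup>2"
      using pencil_parameter_unique[OF sol_pencil(1)[OF u2(1)] sol_pencil(1)[OF u1(1)] S'z] .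
    then have "a2 = - a1" using ne by (auto simp: power2_eq_iff)
    then show False using infinite_corr_opposite[OF u1(1) _ p noneig] u2(1) fin by blast
  qed
  then have "p \<bar>a1\<bar> \<noteq> 0" by (cases "a1 \<ge> 0") simp_all
  then show ?thesis
    using that[of "\<bar>a1\<bar>"] a sol_pencil(1)[OF u1(1)] nonbase by simp
qed


section \<open>Regular points of the pencil\<close>

text \<open>An isotropic plane in dimension four is its own \<open>\<omega>\<close>-complement. The
  complement is rewritten as a Euclidean one, of the images under \<open>omega_mat\<close>, to count
  dimensions.\<close>

lemma lagrangian_span:
  assumes indep: "lin_indep2 a b" and ab: "\<omega> a b = 0" and x: "\<omega> a x = 0" "\<omega> b x = 0"
  obtains \<alpha> \<beta> where "x = \<alpha> *\<^sub>R a + \<beta> *\<^sub>R b"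
proof -
  have dim2: "independent {u, v} \<and> card {u, v} = 2" if uv: "lin_indep2 u v" for u v :: V
  proof -
    have ne: "u \<noteq> v" "u \<noteq> 0" "v \<noteq> 0"
      using uv[unfolded lin_indep2_def, rule_format, of 1 "-1"] uv[unfolded lin_indep2_def, rule_format, of 1 0]
        uv[unfolded lin_indep2_def, rule_format, of 0 1] by auto
    have "u \<notin> span {v}"
    proof
      assume "u \<in> span {v}"
      then obtain k where "u = k *\<^sub>R v" unfolding span_singleton by blast
      then have "1 *\<^sub>R u + (- k) *\<^sub>R v = 0" by simp
      then show False using uv unfolding lin_indep2_def by (metis zero_neq_one)
    qed
    then show ?thesis using ne by (simp add: independent_insert)
  qed
  define W where "W = {y. \<omega> a y = 0 \<and> \<omega> b y = 0}"
  have Aab: "lin_indep2 (omega_mat *v a) (omega_mat *v b)"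
    unfolding lin_indep2_def
  proof (intro allI impI)
    fix \<alpha> \<beta> assume "\<alpha> *\<^sub>R (omega_mat *v a) + \<beta> *\<^sub>R (omega_mat *v b) = 0"
    then have "omega_mat *v (\<alpha> *\<^sub>R a + \<beta> *\<^sub>R b) = 0"
      by (simp add: matrix_vector_right_distrib matrix_vector_mult_scaleR)
    then show "\<alpha> = 0 \<and> \<beta> = 0" using omega_mat_eq_0D indep unfolding lin_indep2_def by blast
  qed
  have W: "W = {y \<in> UNIV. \<forall>x \<in> span {omega_mat *v a, omega_mat *v b}. orthogonal x y}"
  proof -
    have "orthogonal (omega_mat *v w) y \<longleftrightarrow> \<omega> w y = 0" for w y
      unfolding orthogonal_def inner_commute[of "omega_mat *v w"] inner_omega_mat omega_skew[of y] by simp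
    moreover have "orthogonal x y"
      if "x \<in> span {omega_mat *v a, omega_mat *v b}" "orthogonal (omega_mat *v a) y" "orthogonal (omega_mat *v b) y" for x y
    proof -
      have "orthogonal y x"
        by (rule orthogonal_to_span[OF that(1)]) (use that in \<open>auto simp: orthogonal_commute\<close>)
      then show ?thesis by (simp add: orthogonal_commute)
    qed
    moreover have "omega_mat *v a \<in> span {omega_mat *v a, omega_mat *v b}" "omega_mat *v b \<in> span {omega_mat *v a, omega_mat *v b}"
      by (auto intro: span_base)
    ultimately show ?thesis
      unfolding W_def by blast
  qed
  have "dim W + dim (span {omega_mat *v a, omega_mat *v b}) = dim (UNIV :: V set)"
    unfolding W by (rule dim_subspace_orthogonal_to_vectors) (auto simp: subspace_span)
  moreover have "dim (span {omega_mat *v a, omega_mat *v b}) = 2"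
    using dim2[OF Aab] by (simp add: dim_eq_card_independent)
  ultimately have "dim W = 2" by simp
  moreover have "{a, b} \<subseteq> W" using ab omega_skew[of b a] by (simp add: W_def)
  ultimately have "W \<subseteq> span {a, b}"
    using dim2[OF indep] by (intro card_ge_dim_independent) auto
  then have "x \<in> span {a, b}" using x by (auto simp: W_def)
  then obtain k where "x - k *\<^sub>R a \<in> span {b}" by (auto simp: span_insert)
  then obtain l where "x - k *\<^sub>R a = l *\<^sub>R b" by (auto simp: span_singleton)
  then have "x = k *\<^sub>R a + l *\<^sub>R b" by (simp add: algebra_simps)
  then show ?thesis by (rule that)
qed

lemmas N_linear = linear_add[OF linear_N] linear_diff[OF linear_N] linear_scale[OF linear_N] linear_0[OF linear_N]

lemma N_minus [simp]: "N (- a) z = N a z"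
  by (simp add: N_def)

lemma N_X: "N a (X z) = X (N a z)"
  by (simp add: N_def X_linear)

lemma XX_N: "a\<^sup>2 *\<^sub>R X (X (N a z)) = N a z - p a *\<^sub>R z"
proof -
  have ch: "X (X (X (X z))) = - (c *\<^sub>R X (X z) + d *\<^sub>R z)"
    using cayley_hamilton[of z] by (simp only: eq_neg_iff_add_eq_0 add.assoc)
  show ?thesis
    by (simp add: N_def X_linear ch p_def algebra_simps power2_eq_square power4_eq_xxxx)
qed

lemma pencil_degenerate_iff: "S z + (a\<^sup>2 * d) *\<^sub>R S' z = 0 \<longleftrightarrow> N a z = 0"
proof
  assume "S z + (a\<^sup>2 * d) *\<^sub>R S' z = 0"
  then have "\<omega> (X (N a z)) v = 0" for v by (simp add: pencil_N)
  then have "X (N a z) = 0" by (rule omega_nondegenerate)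
  then show "N a z = 0" by simp
qed (simp add: pencil_N X_linear omega_linear)

lemma pencil_form_N: "\<omega> (X (N a z)) z = S z z + a\<^sup>2 * d * S' z z"
  by (simp add: pencil_N[symmetric] blinfun.bilinear_simps)

text \<open>If \<open>N a z = 0\<close>, then \<open>z\<close> is an eigenvector of
  \<open>X^2\<close> for the second root, and the constraint this puts on \<open>u\<close> forces
  \<open>S' u u = 0\<close>, so \<open>z\<close> would be a base point.\<close>

lemma sol_regular:
  assumes u: "sol z a u" and nb: "\<not> (S z z = 0 \<and> S' z z = 0)"
  shows "N a z \<noteq> 0"
proof
  assume Nz: "N a z = 0"
  have a: "a \<noteq> 0" and zu: "z = u + a *\<^sub>R X u" and Su: "S u u = 0" using u by (auto simp: sol_def)
  have z: "z \<noteq> 0" using sol_nonzero[OF u] by simp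
  have p: "p a = 0" using XX_N[of a z] z by (simp add: Nz X_linear)
  \<comment> \<open>The second root of \<open>t^2 + c t + d\<close>: the first is
    \<open>1/a^2\<close> and the product of the roots is \<open>d\<close>.\<close>
  define \<mu> where "\<mu> = a\<^sup>2 * d"
  have Xz: "X (X z) = \<mu> *\<^sub>R z"
  proof -
    have "- (1 + a\<^sup>2 * c) = a ^ 4 * d" using p by (simp add: p_def)
    then have "- (1 + a\<^sup>2 * c) / a\<^sup>2 = \<mu>" using a by (simp add: \<mu>_def power2_eq_square power4_eq_xxxx)
    then show ?thesis using Nz N_eq_0_iff[OF a] by simp
  qed
  define x where "x = inv X u"
  have x: "u = X x" by (simp add: x_def)
  \<comment> \<open>\<open>id + a X\<close> sends \<open>v\<close> to
    \<open>(X^2 - \<mu>) z = 0\<close>. Evaluating \<open>\<omega> v x\<close> once through this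
    kernel relation and once by expanding \<open>v\<close> gives
    \<open>S u u + \<mu> S' u u = 0\<close>.\<close>
  define v where "v = X (X u) - \<mu> *\<^sub>R u"
  have "v + a *\<^sub>R X v = X (X z) - \<mu> *\<^sub>R z" by (simp add: v_def zu X_linear algebra_simps)
  then have v: "v = - (a *\<^sub>R X v)" by (simp add: Xz eq_neg_iff_add_eq_0)
  have "\<omega> v u = \<omega> (X (X u)) u" by (simp add: v_def omega_bilinear)
  also have "\<dots> = 0" by (simp add: omega_X)
  finally have vu: "\<omega> v u = 0" .
  have "\<omega> v x = \<omega> (- (a *\<^sub>R X v)) x" using v by simp
  also have "\<dots> = a * \<omega> v u" by (simp add: omega_bilinear omega_X x)
  finally have "\<omega> v x = 0" by (simp add: vu)
  moreover have "\<omega> v x = \<omega> (X (X u)) x - \<mu> * \<omega> u x" by (simp add: v_def omega_bilinear)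
  moreover have "\<omega> (X (X u)) x = - S u u" using omega_X[of "X u" x] by (simp add: S_omega flip: x)
  moreover have "\<omega> u x = S' u u" by (simp add: x S'_X_X S_omega)
  ultimately have "\<mu> * S' u u = 0" by (simp add: Su)
  then have "S' u u = 0" using a d_nonzero by (simp add: \<mu>_def)
  then have "S' z z = 0" using sol_pencil(2)[OF u] by simp
  then show False using sol_pencil(1)[OF u] nb by simp
qed

text \<open>
  The vector \<open>n\<close> spans the kernel of \<open>id - a X\<close>: a second eigenvector would give a Lagrangian
  eigenspace, making \<open>X\<^sup>2\<close> scalar and \<open>N a z = 0\<close>. So \<open>z\<close>, which is orthogonal to \<open>n\<close>, lies in the
  range of \<open>id + a X\<close>. It is not in the range of \<open>id - a X\<close>, which provides the \<open>y\<close> in the kernel of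
  \<open>id + a X\<close> by which a preimage of \<open>z\<close> is moved onto the quadric.
\<close>

lemma regular_sol:
  assumes a: "a \<noteq> 0" and pa: "p a = 0" and pen: "S z z + a\<^sup>2 * d * S' z z = 0"
    and nb: "\<not> (S z z = 0 \<and> S' z z = 0)" and n: "N a z + a *\<^sub>R X (N a z) \<noteq> 0"
  shows "\<exists>u. sol z a u"
proof -
  define n where "n = N a z + a *\<^sub>R X (N a z)"
  have XXN: "a\<^sup>2 *\<^sub>R X (X (N a v)) = N a v" for v
    using XX_N[of a v] pa by simp
  have aXn: "a *\<^sub>R X n = n"
    using XXN[of z] by (simp add: n_def X_linear power2_eq_square scaleR_add_right add.commute)
  then have Xn: "X n = (1 / a) *\<^sub>R n" using eq_scaleR_inverse_iff[OF a] by blast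
  have "\<omega> (X (X z)) z = 0" by (simp add: omega_X)
  then have "\<omega> (N a z) z = 0" by (simp add: N_def omega_bilinear)
  moreover have "\<omega> (X (N a z)) z = 0" using pen by (simp add: pencil_form_N)
  ultimately have nz: "\<omega> n z = 0" by (simp add: n_def omega_bilinear)
  have Nz: "N a z \<noteq> 0" using n by (auto simp: X_linear)
  have range_perp: "\<omega> z w = 0" if w: "X w = (1 / a) *\<^sub>R w" for w
  proof (rule ccontr)
    assume zw: "\<omega> z w \<noteq> 0"
    have indep: "lin_indep2 n w"
    proof (rule lin_indep2I)
      show "n \<noteq> 0" using n by (simp add: n_def)
      show "w \<noteq> k *\<^sub>R n" for k
        using zw nz omega_skew[of z n] by (auto simp: blinfun.bilinear_simps)
    qed
    have perp: "\<omega> v (x + a *\<^sub>R X x) = 0" if v: "X v = (1 / a) *\<^sub>R v" for v x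
    proof -
      have "\<omega> v (a *\<^sub>R X x) = - \<omega> (a *\<^sub>R X v) x" by (simp add: omega_bilinear omega_X)
      then show ?thesis using a by (simp add: v omega_bilinear)
    qed
    have "(2 * inverse a) * \<omega> n w = 0"
      using omega_X[of n w] unfolding Xn w by (simp add: omega_bilinear divide_inverse)
    then have nw: "\<omega> n w = 0" using a by simp
    \<comment> \<open>The range of \<open>id + a X\<close> is orthogonal to \<open>n\<close> and
      \<open>w\<close>, hence lies in their span, which consists of vectors killed by
      \<open>id - a X\<close>. Thus \<open>id - a^2 X^2\<close> vanishes.\<close>
    have XX: "X (X v) = (1 / a\<^sup>2) *\<^sub>R v" for v
    proof -
      obtain \<alpha> \<beta> where e: "v + a *\<^sub>R X v = \<alpha> *\<^sub>R n + \<beta> *\<^sub>R w"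
        using lagrangian_span[OF indep nw perp[OF Xn] perp[OF w]] .
      then have "X (v + a *\<^sub>R X v) = (1 / a) *\<^sub>R (v + a *\<^sub>R X v)"
        unfolding e by (simp add: X_linear Xn w algebra_simps)
      then have "a *\<^sub>R X (v + a *\<^sub>R X v) = v + a *\<^sub>R X v"
        using eq_scaleR_inverse_iff[OF a] by blast
      then have "a\<^sup>2 *\<^sub>R X (X v) = v" by (simp add: X_linear power2_eq_square algebra_simps)
      moreover have "a\<^sup>2 \<noteq> 0" using a by simp
      ultimately show ?thesis using eq_scaleR_inverse_iff by blast
    qed
    let ?\<mu> = "- (1 + a\<^sup>2 * c) / a\<^sup>2"
    obtain v where v: "v \<noteq> 0" "X (X v) = ?\<mu> *\<^sub>R v"
      using char_root_eigenvector[of ?\<mu>] p_other_root[OF a] pa by auto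
    then have "(1 / a\<^sup>2) *\<^sub>R v = ?\<mu> *\<^sub>R v" using XX[of v] by simp
    then have "1 / a\<^sup>2 = ?\<mu>" using v(1) by (simp only: scaleR_right_imp_eq[OF v(1)])
    then have "X (X z) = ?\<mu> *\<^sub>R z" using XX[of z] by simp
    then show False using Nz N_eq_0_iff[OF a] by blast
  qed
  obtain u0 where u0: "z = u0 + a *\<^sub>R X u0"
    using mem_range_add_X[of a z, OF range_perp a] by blast
  have "\<exists>y. X y = (1 / (- a)) *\<^sub>R y \<and> \<omega> z y \<noteq> 0"
  proof (rule ccontr)
    assume "\<not> ?thesis"
    then obtain v where v: "z = v + (- a) *\<^sub>R X v"
      using mem_range_add_X[of "- a" z] a by auto
    have e: "N a z = N a v - a *\<^sub>R X (N a v)"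
      unfolding v by (simp add: N_linear N_X)
    \<comment> \<open>With \<open>z = v - a X v\<close>, \<open>n\<close> becomes
      \<open>(id - a^2 X^2) (N a v) = p a v\<close>, which is zero.\<close>
    have "n = N a v - a\<^sup>2 *\<^sub>R X (X (N a v))"
      unfolding n_def e by (simp add: X_linear power2_eq_square algebra_simps)
    then have "n = 0" by (simp add: XXN)
    then show False using n by (simp add: n_def)
  qed
  then obtain y where y: "X y = (1 / (- a)) *\<^sub>R y" "\<omega> z y \<noteq> 0" by blast
  have aXy: "a *\<^sub>R X y = - y" using y(1) a by simp
  have "\<omega> z y = \<omega> u0 y - \<omega> u0 (a *\<^sub>R X y)"
    unfolding u0 by (simp add: omega_bilinear omega_X)
  then have "\<omega> z y = 2 * \<omega> u0 y" unfolding aXy by (simp add: omega_bilinear)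
  moreover have "S u0 y = (1 / a) * \<omega> u0 y" unfolding S_omega omega_X by (simp add: y(1) omega_bilinear)
  ultimately have S0: "S u0 y \<noteq> 0" using y(2) a by simp
  have Sy: "S y y = 0" by (simp add: S_omega y(1) omega_bilinear)
  \<comment> \<open>As \<open>y\<close> is isotropic, \<open>S u u\<close> is affine in the
    coefficient of \<open>y\<close>; this is its zero.\<close>
  define u where "u = u0 + (- S u0 u0 / (2 * S u0 y)) *\<^sub>R y"
  have "S u u = 0" using S0 Sy S_sym[of y u0] by (simp add: u_def S_linear)
  moreover have zu: "z = u + a *\<^sub>R X u"
  proof -
    have "u + a *\<^sub>R X u = (u0 + a *\<^sub>R X u0) + (- S u0 u0 / (2 * S u0 y)) *\<^sub>R (y + a *\<^sub>R X y)"
      by (simp add: u_def X_linear algebra_simps)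
    then show ?thesis by (simp add: aXy u0)
  qed
  moreover have "\<nexists>k. X u = k *\<^sub>R u"
    using parallel_add_X(2)[OF zu] eigenvector_in_base nb by blast
  ultimately show ?thesis using a unfolding sol_def by blast
qed

text \<open>For exceptional \<open>a\<close>, the vectors \<open>N a z + a X (N a z)\<close> and
  \<open>N a z - a X (N a z)\<close> add up to \<open>2 N a z\<close>, so one of the two signs of
  \<open>a\<close> admits \<open>regular_sol\<close>.\<close>

lemma regular_imp_sol:
  assumes a: "a \<noteq> 0" and pen: "S z z + a\<^sup>2 * d * S' z z = 0"
    and nb: "\<not> (S z z = 0 \<and> S' z z = 0)" and n: "N a z \<noteq> 0"
  shows "\<exists>b u. sol z b u"
proof (cases "p a = 0")
  case False
  have "\<nexists>k. X z = k *\<^sub>R z" using eigenvector_in_base nb by blast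
  then show ?thesis using sol_resolvent[OF False a pen] by blast
next
  case True
  show ?thesis
  proof (cases "N a z + a *\<^sub>R X (N a z) = 0")
    case False
    then show ?thesis using regular_sol[OF a True pen nb] by blast
  next
    case eq: True
    have "N (- a) z + (- a) *\<^sub>R X (N (- a) z) = 2 *\<^sub>R N a z - (N a z + a *\<^sub>R X (N a z))"
      by (simp add: scaleR_2)
    then have "N (- a) z + (- a) *\<^sub>R X (N (- a) z) \<noteq> 0" using n by (simp add: eq)
    then show ?thesis using regular_sol[of "- a" z] a True pen nb by auto
  qed
qed


section \<open>The billiard map\<close>

lemma X_in_symplectic_algebra: "X \<in> symplectic_algebra \<omega>"
  by (simp add: symplectic_algebra_def linear_X omega_X)

lemma dual_map_conjugate_iff: "dual_map X \<circ> R \<circ> X = S \<longleftrightarrow> R = S'"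
proof -
  have bl: "blinfun_apply (Blinfun X) = X"
    using linear_X by (simp add: bounded_linear_Blinfun_apply linear_conv_bounded_linear)
  have dual: "dual_map X \<nu> v = \<nu> (X v)" for \<nu> v
    by (simp add: dual_map_def bl)
  have S': "dual_map X \<circ> S' \<circ> X = S"
    by (intro ext blinfun_eqI) (simp add: dual S'_X_X)
  show ?thesis
  proof
    assume R: "dual_map X \<circ> R \<circ> X = S"
    show "R = S'"
    proof (intro ext blinfun_eqI)
      fix u v
      have "R (X (inv X u)) (X (inv X v)) = S' (X (inv X u)) (X (inv X v))"
        using fun_cong[OF trans[OF R S'[symmetric]], of "inv X u"]
        by (simp add: dual[symmetric] del: X_inv_X)
      then show "R u v = S' u v" by simp
    qed
  qed (simp add: S')
qed

definition I :: "real \<Rightarrow> V set set" where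
  "I s = {span {v} | v. v \<noteq> 0 \<and> S v v = - s * det (matrix X) * S' v v}"

lemma mem_I_iff: "span {v} \<in> I (a\<^sup>2) \<longleftrightarrow> v \<noteq> 0 \<and> S v v + a\<^sup>2 * d * S' v v = 0"
proof -
  have "span {v} \<in> I (a\<^sup>2) \<longleftrightarrow> v \<noteq> 0 \<and> S v v = - a\<^sup>2 * det (matrix X) * S' v v"
    unfolding I_def by (rule mem_projective_locus_iff) (simp add: S_linear S'_linear)
  then show ?thesis by (simp add: d_def eq_neg_iff_add_eq_0)
qed

lemma I_cases:
  assumes "Z \<in> I (a\<^sup>2)"
  obtains z where "Z = span {z}" "z \<noteq> 0" "S z z + a\<^sup>2 * d * S' z z = 0"
  using assms mem_I_iff unfolding I_def by blast

lemma mem_base_iff: "span {v} \<in> quadric S \<inter> quadric S' \<longleftrightarrow> v \<noteq> 0 \<and> S v v = 0 \<and> S' v v = 0"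
  by (auto simp: mem_quadric_iff linear_S linear_S')

lemma I_Int:
  assumes "0 < \<sigma>" "0 < \<tau>" "\<sigma> \<noteq> \<tau>"
  shows "I (\<sigma>\<^sup>2) \<inter> I (\<tau>\<^sup>2) = quadric S \<inter> quadric S'"
proof
  show "I (\<sigma>\<^sup>2) \<inter> I (\<tau>\<^sup>2) \<subseteq> quadric S \<inter> quadric S'"
  proof
    fix Z assume Z: "Z \<in> I (\<sigma>\<^sup>2) \<inter> I (\<tau>\<^sup>2)"
    then obtain z where z: "Z = span {z}" "z \<noteq> 0" "S z z + \<sigma>\<^sup>2 * d * S' z z = 0"
      by (auto elim: I_cases)
    have t: "S z z + \<tau>\<^sup>2 * d * S' z z = 0" using Z z(1) mem_I_iff by blast
    have "\<sigma>\<^sup>2 \<noteq> \<tau>\<^sup>2" using assms by (simp add: power2_eq_iff)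
    then have "S' z z = 0" using pencil_parameter_unique[OF z(3) t] by blast
    then show "Z \<in> quadric S \<inter> quadric S'"
      using z unfolding z(1) mem_base_iff by simp
  qed
  show "quadric S \<inter> quadric S' \<subseteq> I (\<sigma>\<^sup>2) \<inter> I (\<tau>\<^sup>2)"
  proof
    fix Z assume Z: "Z \<in> quadric S \<inter> quadric S'"
    then obtain z where "Z = span {z}" by (auto simp: quadric_def)
    then show "Z \<in> I (\<sigma>\<^sup>2) \<inter> I (\<tau>\<^sup>2)" using Z mem_base_iff[of z] by (simp add: mem_I_iff)
  qed
qed

lemma correspondents_eq:
  "Q \<in> {quadric S, quadric S'} \<Longrightarrow> correspondents \<omega> Q Z = {Z'. corr Z Z'}"
  by (auto simp: correspondents_def corr_S corr_S')

lemma corr_cases: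
  assumes "corr Z Z'"
  obtains z a u where "Z = span {z}" "sol z a u" "Z' = span {2 *\<^sub>R u - z}"
proof -
  obtain z where z: "Z = span {z}" using assms unfolding corr_def by blast
  have "z \<noteq> 0"
  proof
    assume "z = 0"
    obtain u a where u: "a \<noteq> 0" "S u u = 0" "\<nexists>k. X u = k *\<^sub>R u" "Z = span {u + a *\<^sub>R X u}"
      using assms unfolding corr_def by blast
    then have "sol (u + a *\<^sub>R X u) a u" by (simp add: sol_def)
    from sol_nonzero(2)[OF this] show False
      using u(4) \<open>z = 0\<close> unfolding z span_singleton_eq_iff by auto
  qed
  then obtain a u where "sol z a u" "Z' = span {2 *\<^sub>R u - z}"
    using assms unfolding z by (auto simp: corr_iff_sol)
  then show ?thesis using that z by blast
qed

lemma not_eigenvalue_iff: "0 < a \<Longrightarrow> \<not> is_eigenvalue X (1 / a) \<longleftrightarrow> p a \<noteq> 0"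
  using is_eigenvalue_iff_p[of a] by simp

lemma sol_mem_I:
  assumes "sol z a u"
  shows "span {z} \<in> I (\<bar>a\<bar>\<^sup>2)" "0 < \<bar>a\<bar>"
  unfolding mem_I_iff power2_abs using sol_nonzero(2)[OF assms] sol_pencil(1)[OF assms] assms
  by (auto simp: sol_def)

lemma corr_nonempty_subset: "{Z. {Z'. corr Z Z'} \<noteq> {}} \<subseteq> (\<Union>\<sigma>\<in>{0<..}. I (\<sigma>\<^sup>2))"
proof
  fix Z assume "Z \<in> {Z. {Z'. corr Z Z'} \<noteq> {}}"
  then obtain z a u where "Z = span {z}" "sol z a u" by (auto elim: corr_cases)
  then show "Z \<in> (\<Union>\<sigma>\<in>{0<..}. I (\<sigma>\<^sup>2))"
    using sol_mem_I by blast
qed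

lemma corr_domain_regular:
  "{Z. {Z'. corr Z Z'} \<noteq> {}} - quadric S \<inter> quadric S' =
    {span {z} | z \<sigma>. 0 < \<sigma> \<and> span {z} \<in> I (\<sigma>\<^sup>2) \<and> S z + (\<sigma>\<^sup>2 * d) *\<^sub>R S' z \<noteq> 0} - quadric S \<inter> quadric S'"
    (is "?L = ?R")
proof
  show "?L \<subseteq> ?R"
  proof
    fix Z assume Z: "Z \<in> ?L"
    then obtain z a u where z: "Z = span {z}" "sol z a u" by (auto elim: corr_cases)
    have "\<not> (S z z = 0 \<and> S' z z = 0)"
      using Z z mem_base_iff[of z] sol_nonzero(2)[OF z(2)] by blast
    then have "N a z \<noteq> 0" by (rule sol_regular[OF z(2)])
    then have "S z + (\<bar>a\<bar>\<^sup>2 * d) *\<^sub>R S' z \<noteq> 0" by (simp add: pencil_degenerate_iff)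
    then show "Z \<in> ?R" using sol_mem_I[OF z(2)] Z z(1) by blast
  qed
  show "?R \<subseteq> ?L"
  proof
    fix Z assume Z: "Z \<in> ?R"
    then obtain z \<sigma> where z: "Z = span {z}" "0 < \<sigma>" "span {z} \<in> I (\<sigma>\<^sup>2)" "S z + (\<sigma>\<^sup>2 * d) *\<^sub>R S' z \<noteq> 0"
      by blast
    have z0: "z \<noteq> 0" "S z z + \<sigma>\<^sup>2 * d * S' z z = 0" using z(3) by (simp_all add: mem_I_iff)
    have "Z \<notin> quadric S \<inter> quadric S'" using Z unfolding Diff_iff by (rule conjunct2)
    then have nb: "\<not> (S z z = 0 \<and> S' z z = 0)"
      using z0(1) unfolding z(1) mem_base_iff by blast
    have "N \<sigma> z \<noteq> 0" using z(4) by (simp add: pencil_degenerate_iff)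
    then obtain b u where "sol z b u" using regular_imp_sol[OF _ z0(2) nb] z(2) by auto
    then have "corr Z (span {2 *\<^sub>R u - z})" unfolding z(1) corr_iff_sol[OF z0(1)] by blast
    then show "Z \<in> ?L" using Z by blast
  qed
qed

text \<open>The reflection preserves \<open>S\<close> and \<open>S'\<close> separately, so
  \<open>\<sigma>\<close> need not be the parameter of the correspondence; this matters at base
  points.\<close>

lemma corr_I_invariant:
  assumes "Z \<in> I (\<sigma>\<^sup>2)" "corr Z Z'"
  shows "Z' \<in> I (\<sigma>\<^sup>2)"
proof -
  obtain z a u where z: "Z = span {z}" "sol z a u" "Z' = span {2 *\<^sub>R u - z}"
    using assms(2) by (rule corr_cases)
  then show ?thesis
    using assms(1) sol_nonzero[OF z(2)] sol_reflect_forms[OF z(2)] by (simp add: mem_I_iff)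
qed

definition D :: "V set set" where
  "D = {Z \<in> RP3. card {Z'. corr Z Z'} = 2}"

lemma billiard_domain_eq: "Q \<in> {quadric S, quadric S'} \<Longrightarrow> billiard_domain \<omega> Q = D"
  by (simp only: billiard_domain_def D_def correspondents_eq)

lemma D_cases:
  assumes "Z \<in> D"
  obtains z a where "Z = span {z}" "z \<noteq> 0" "a > 0" "p a \<noteq> 0" "S z z + a\<^sup>2 * d * S' z z = 0"
    "\<not> (S z z = 0 \<and> S' z z = 0)"
proof -
  obtain z where z: "Z = span {z}" "z \<noteq> 0" using assms by (auto simp: D_def RP3_def)
  have "card {Z'. corr (span {z}) Z'} = 2" using assms z(1) by (simp add: D_def)
  from card_corr_2[OF z(2) this] show ?thesis using that[OF z] by blast
qed

lemma mem_D:
  assumes z: "z \<noteq> 0" "\<not> (S z z = 0 \<and> S' z z = 0)"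
    and a: "a \<noteq> 0" "p a \<noteq> 0" "S z z + a\<^sup>2 * d * S' z z = 0"
  shows "span {z} \<in> D"
  using corr_nonexceptional[OF assms] z(1) unfolding D_def RP3_def by auto

lemma D_eq: "D = (\<Union>\<sigma>\<in>{\<sigma>. 0 < \<sigma> \<and> \<not> is_eigenvalue X (1 / \<sigma>)}. I (\<sigma>\<^sup>2)) - quadric S \<inter> quadric S'"
    (is "_ = ?R")
proof
  show "D \<subseteq> ?R"
  proof
    fix Z assume "Z \<in> D"
    then obtain z a where z: "Z = span {z}" "z \<noteq> 0" "a > 0" "p a \<noteq> 0" "S z z + a\<^sup>2 * d * S' z z = 0"
      "\<not> (S z z = 0 \<and> S' z z = 0)" by (rule D_cases)
    have "Z \<in> I (a\<^sup>2)" "Z \<notin> quadric S \<inter> quadric S'" "\<not> is_eigenvalue X (1 / a)"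
      using z unfolding z(1) mem_I_iff mem_base_iff not_eigenvalue_iff[OF z(3)] by auto
    then show "Z \<in> ?R" using z(3) by blast
  qed
  show "?R \<subseteq> D"
  proof
    fix Z assume Z: "Z \<in> ?R"
    then obtain a where a: "0 < a" "\<not> is_eigenvalue X (1 / a)" "Z \<in> I (a\<^sup>2)" by blast
    obtain z where z: "Z = span {z}" "z \<noteq> 0" "S z z + a\<^sup>2 * d * S' z z = 0"
      using a(3) by (rule I_cases)
    have "\<not> (S z z = 0 \<and> S' z z = 0)" using Z z(2) mem_base_iff[of z] unfolding z(1) by blast
    then show "Z \<in> D" unfolding z(1)
      using mem_D[OF z(2), of a] z(3) a not_eigenvalue_iff by simp
  qed
qed

lemma cayley_image_span: "p a \<noteq> 0 \<Longrightarrow> cayley X a ` span {z} = span {cayley X a z}"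
  using linear_span_image[OF linear_cayley, of a "{z}"] by simp

lemma cayley_image_I:
  assumes "p a \<noteq> 0" "Z \<in> I (b\<^sup>2)"
  shows "cayley X a ` Z \<in> I (b\<^sup>2)" "cayley X (- a) ` cayley X a ` Z = Z"
proof -
  have pm: "p (- a) \<noteq> 0" using assms by simp
  obtain z where z: "Z = span {z}" "z \<noteq> 0" "S z z + b\<^sup>2 * d * S' z z = 0"
    using assms(2) by (rule I_cases)
  then show "cayley X a ` Z \<in> I (b\<^sup>2)" "cayley X (- a) ` cayley X a ` Z = Z"
    using assms(1) pm
    by (simp_all only: cayley_image_span[OF assms(1)] cayley_image_span[OF pm] mem_I_iff cayley_forms
        cayley_eq_0_iff cayley_minus_cayley simp_thms)
qed

lemma bij_betw_cayley_I:
  assumes "p a \<noteq> 0"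
  shows "bij_betw (image (cayley X a)) (I (b\<^sup>2)) (I (b\<^sup>2))"
proof (rule bij_betw_byWitness[where f' = "image (cayley X (- a))"])
  have pm: "p (- a) \<noteq> 0" using assms by simp
  show "\<forall>Z\<in>I (b\<^sup>2). cayley X (- a) ` cayley X a ` Z = Z" "\<forall>Z\<in>I (b\<^sup>2). cayley X a ` cayley X (- a) ` Z = Z"
    using cayley_image_I(2)[OF assms] cayley_image_I(2)[OF pm] by auto
  show "image (cayley X a) ` I (b\<^sup>2) \<subseteq> I (b\<^sup>2)" "image (cayley X (- a)) ` I (b\<^sup>2) \<subseteq> I (b\<^sup>2)"
    using cayley_image_I(1)[OF assms] cayley_image_I(1)[OF pm] by auto
qed

lemma corr_cayley:
  assumes "0 < a" "p a \<noteq> 0" "span {z} \<in> I (a\<^sup>2)" "span {X z} \<noteq> span {z}"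
  shows "corr (span {z}) (span {cayley X a z})"
proof -
  have z: "z \<noteq> 0" "S z z + a\<^sup>2 * d * S' z z = 0" using assms(3) by (simp_all add: mem_I_iff)
  have "sol z a (resolvent a z)"
    using sol_resolvent[OF assms(2) _ z(2)] assms(1,4) span_X_eq_iff[OF z(1)] by simp
  then show ?thesis unfolding corr_iff_sol[OF z(1)] cayley_resolvent[OF assms(2)] by blast
qed

definition param :: "V set \<Rightarrow> real" where
  "param Z = (THE a. 0 < a \<and> Z \<in> I (a\<^sup>2))"

lemma param_eq:
  assumes "0 < a" "Z \<in> I (a\<^sup>2)" "Z \<notin> quadric S \<inter> quadric S'"
  shows "param Z = a"
  unfolding param_def
proof (rule the_equality)
  show "b = a" if "0 < b \<and> Z \<in> I (b\<^sup>2)" for b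
    using I_Int[of b a] that assms by blast
qed (use assms in blast)

text \<open>The two branches are \<open>\<epsilon> = 1\<close> and \<open>\<epsilon> = -1\<close>. The parameter is unique only outside the base locus.\<close>

definition billiard :: "real \<Rightarrow> V set \<Rightarrow> V set" where
  "billiard \<epsilon> Z = cayley X (\<epsilon> * param Z) ` Z"

lemma billiard_D:
  assumes "\<epsilon> \<in> {1, - 1}" "Z \<in> D"
  shows "billiard \<epsilon> Z \<in> D" "billiard (- \<epsilon>) (billiard \<epsilon> Z) = Z"
proof -
  obtain z a where z: "Z = span {z}" "z \<noteq> 0" "a > 0" "p a \<noteq> 0" "S z z + a\<^sup>2 * d * S' z z = 0"
    "\<not> (S z z = 0 \<and> S' z z = 0)" using assms(2) by (rule D_cases)
  have pe: "p (\<epsilon> * a) \<noteq> 0" using z(4) assms(1) by auto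
  have ZI: "Z \<in> I (a\<^sup>2)" "Z \<notin> quadric S \<inter> quadric S'" 
    using z unfolding z(1) mem_I_iff mem_base_iff by auto
  have b: "billiard \<epsilon> Z = cayley X (\<epsilon> * a) ` Z"
    unfolding billiard_def param_eq[OF z(3) ZI] ..
  have b': "billiard \<epsilon> Z = span {cayley X (\<epsilon> * a) z}"
    using b cayley_image_span[OF pe] by (simp only: z(1))
  let ?z = "cayley X (\<epsilon> * a) z"
  have z': "?z \<noteq> 0" "S ?z ?z = S z z" "S' ?z ?z = S' z z"
    using z(2) cayley_forms[OF pe] cayley_eq_0_iff[OF pe] by simp_all
  show "billiard \<epsilon> Z \<in> D"
    unfolding b' using z z' by (intro mem_D[where a = a]) simp_all
  have "billiard \<epsilon> Z \<in> I (a\<^sup>2)" "billiard \<epsilon> Z \<notin> quadric S \<inter> quadric S'"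
    using z z' unfolding b' mem_I_iff mem_base_iff by auto
  then have "param (billiard \<epsilon> Z) = a" using param_eq[OF z(3)] by blast
  then have "billiard (- \<epsilon>) (billiard \<epsilon> Z) = cayley X (- (\<epsilon> * a)) ` cayley X (\<epsilon> * a) ` Z"
    unfolding billiard_def[of "- \<epsilon>"] by (simp add: b)
  then show "billiard (- \<epsilon>) (billiard \<epsilon> Z) = Z"
    using cayley_image_I(2)[OF pe ZI(1)] by simp
qed

lemma billiard_formula:
  assumes "0 < a" "p a \<noteq> 0" "span {z} \<in> I (a\<^sup>2) \<inter> D"
  shows "billiard 1 (span {z}) = span {cayley X a z}"
proof -
  have "span {z} \<notin> quadric S \<inter> quadric S'" using assms(3) unfolding D_eq by blast
  then have "param (span {z}) = a" using param_eq assms by blast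
  then show ?thesis unfolding billiard_def by (simp add: cayley_image_span assms(2))
qed

text \<open>The sign \<open>+1\<close> is a consistent branch: the parameter is constant along
  orbits, and the Cayley transforms at \<open>a\<close> and \<open>- a\<close> are inverse to each
  other.\<close>

lemma outer_billiard_map_billiard:
  assumes Q: "Q \<in> {quadric S, quadric S'}"
  shows "outer_billiard_map \<omega> Q (billiard 1)"
proof -
  have bij: "bij_betw (billiard 1) D D"
    using billiard_D[of 1] billiard_D[of "- 1"]
    by (intro bij_betw_byWitness[where f' = "billiard (- 1)"]) auto
  have "{Z'. corr Z Z'} = {billiard 1 Z, inv_into D (billiard 1) Z}" if Z: "Z \<in> D" for Z
  proof -
    have inv: "inv_into D (billiard 1) Z = billiard (- 1) Z"
      using billiard_D[of "- 1" Z] Z by (intro inv_into_f_eq bij_betw_imp_inj_on[OF bij]) auto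
    obtain z a where z: "Z = span {z}" "z \<noteq> 0" "a > 0" "p a \<noteq> 0" "S z z + a\<^sup>2 * d * S' z z = 0"
      "\<not> (S z z = 0 \<and> S' z z = 0)" using Z by (rule D_cases)
    have ZI: "Z \<in> I (a\<^sup>2)" "Z \<notin> quadric S \<inter> quadric S'" 
      using z unfolding z(1) mem_I_iff mem_base_iff by auto
    have "billiard 1 Z = span {cayley X a z}" "billiard (- 1) Z = span {cayley X (- a) z}"
      unfolding billiard_def param_eq[OF z(3) ZI] using z(4) by (simp_all add: z(1) cayley_image_span)
    then show ?thesis
      unfolding inv unfolding z(1) using corr_nonexceptional(1)[OF z(2,6) _ z(4,5)] z(3) by simp
  qed
  then show ?thesis
    using bij unfolding outer_billiard_map_def billiard_domain_eq[OF Q] correspondents_eq[OF Q] by blast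
qed

text \<open>Independent of the branch: the image and the preimage of a point are both correspondents
  of it, which gives the two inclusions.\<close>

lemma outer_billiard_map_I:
  assumes Q: "Q \<in> {quadric S, quadric S'}" and T: "outer_billiard_map \<omega> Q T"
  shows "T ` (I (\<sigma>\<^sup>2) \<inter> D) = I (\<sigma>\<^sup>2) \<inter> D"
proof -
  have bij: "bij_betw T D D"
    and corr: "\<And>Z. Z \<in> D \<Longrightarrow> {Z'. corr Z Z'} = {T Z, inv_into D T Z}"
    using T unfolding outer_billiard_map_def billiard_domain_eq[OF Q] correspondents_eq[OF Q] by blast+
  show ?thesis
  proof
    show "T ` (I (\<sigma>\<^sup>2) \<inter> D) \<subseteq> I (\<sigma>\<^sup>2) \<inter> D"
    proof
      fix Y assume "Y \<in> T ` (I (\<sigma>\<^sup>2) \<inter> D)"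
      then obtain Z where Z: "Z \<in> I (\<sigma>\<^sup>2)" "Z \<in> D" "Y = T Z" by blast
      have "corr Z Y" using corr[OF Z(2)] Z(3) by blast
      then show "Y \<in> I (\<sigma>\<^sup>2) \<inter> D"
        using corr_I_invariant[OF Z(1)] bij_betwE[OF bij] Z by blast
    qed
    show "I (\<sigma>\<^sup>2) \<inter> D \<subseteq> T ` (I (\<sigma>\<^sup>2) \<inter> D)"
    proof
      fix Z assume Z: "Z \<in> I (\<sigma>\<^sup>2) \<inter> D"
      let ?Y = "inv_into D T Z"
      have "corr Z ?Y" using corr Z by blast
      then have "?Y \<in> I (\<sigma>\<^sup>2)" using corr_I_invariant Z by blast
      moreover have "?Y \<in> D" "T ?Y = Z"
        using Z bij_betw_imp_surj_on[OF bij] by (simp_all add: inv_into_into f_inv_into_f)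
      ultimately show "Z \<in> T ` (I (\<sigma>\<^sup>2) \<inter> D)" by (metis IntI image_eqI)
    qed
  qed
qed

end

theorem propositionA2:
  fixes \<omega> S S' :: "V \<Rightarrow> V_dual" and X :: "V \<Rightarrow> V"
    and \<Sigma> \<Sigma>' :: "V set set" and I :: "real \<Rightarrow> V set set"
  assumes "symplectic_form \<omega>"
    and "symmetric_form S" and "bij S"
  defines "X \<equiv> inv \<omega> \<circ> S"
    and "S' \<equiv> (\<lambda>v. - \<omega> (inv S (\<omega> v)))"
    and "\<Sigma> \<equiv> quadric S"
    and "\<Sigma>' \<equiv> quadric S'"
    and "I \<equiv> (\<lambda>s. {span {v} | v. v \<noteq> 0 \<and> S v v = - s * det (matrix X) * S' v v})"
  shows
    "\<comment> \<open>generator and polar surface\<close>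
     X \<in> symplectic_algebra \<omega>
     \<and> symmetric_form S' \<and> bij S'
     \<and> (\<forall>R :: V \<Rightarrow> V_dual. dual_map X \<circ> R \<circ> X = S \<longleftrightarrow> R = S')
     \<and> polar_surface \<omega> \<Sigma> = \<Sigma>'
    \<comment> \<open>two members of the pencil meet exactly in its base locus\<close>
     \<and> (\<forall>\<sigma>>0. \<forall>\<tau>>0. \<sigma> \<noteq> \<tau> \<longrightarrow> I (\<sigma>\<^sup>2) \<inter> I (\<tau>\<^sup>2) = \<Sigma> \<inter> \<Sigma>')
    \<comment> \<open>the member is a degenerate quadric exactly for the exceptional parameters\<close>
     \<and> (\<forall>\<sigma>>0. bij (\<lambda>v. S v + (\<sigma>\<^sup>2 * det (matrix X)) *\<^sub>R S' v) \<longleftrightarrow> \<not> is_eigenvalue X (1 / \<sigma>))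
    \<comment> \<open>domain of the map, then of the correspondence; the latter is the region in which the
        quadrics, for all \<open>\<sigma>\<close>, form a smooth foliation, i.e. the differential of the quadratic
        form does not vanish\<close>
     \<and> (\<forall>Q \<in> {\<Sigma>, \<Sigma>'}. billiard_domain \<omega> Q =
           (\<Union>\<sigma> \<in> {\<sigma>. 0 < \<sigma> \<and> \<not> is_eigenvalue X (1 / \<sigma>)}. I (\<sigma>\<^sup>2)) - \<Sigma> \<inter> \<Sigma>')
     \<and> (\<forall>Q \<in> {\<Sigma>, \<Sigma>'}. {Z. correspondents \<omega> Q Z \<noteq> {}} \<subseteq> (\<Union>\<sigma> \<in> {0<..}. I (\<sigma>\<^sup>2)))
     \<and> (\<forall>Q \<in> {\<Sigma>, \<Sigma>'}. {Z. correspondents \<omega> Q Z \<noteq> {}} - \<Sigma> \<inter> \<Sigma>' =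
           {span {z} | z \<sigma>. 0 < \<sigma> \<and> span {z} \<in> I (\<sigma>\<^sup>2) \<and>
              S z + (\<sigma>\<^sup>2 * det (matrix X)) *\<^sub>R S' z \<noteq> 0} - \<Sigma> \<inter> \<Sigma>')
    \<comment> \<open>invariance\<close>
     \<and> (\<forall>Q \<in> {\<Sigma>, \<Sigma>'}. \<forall>\<sigma>>0. \<forall>Z \<in> I (\<sigma>\<^sup>2). correspondents \<omega> Q Z \<subseteq> I (\<sigma>\<^sup>2))
     \<and> (\<forall>Q \<in> {\<Sigma>, \<Sigma>'}. \<forall>T. outer_billiard_map \<omega> Q T \<longrightarrow>
           (\<forall>\<sigma>>0. T ` (I (\<sigma>\<^sup>2) \<inter> billiard_domain \<omega> Q) = I (\<sigma>\<^sup>2) \<inter> billiard_domain \<omega> Q))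
    \<comment> \<open>explicit formula\<close>
     \<and> (\<forall>\<sigma>>0. \<not> is_eigenvalue X (1 / \<sigma>) \<longrightarrow>
           bij (\<lambda>v. v + \<sigma> *\<^sub>R X v) \<and> bij (\<lambda>v. v - \<sigma> *\<^sub>R X v)
           \<and> bij_betw (image (cayley X \<sigma>)) (I (\<sigma>\<^sup>2)) (I (\<sigma>\<^sup>2))
           \<and> (\<forall>Q \<in> {\<Sigma>, \<Sigma>'}. \<forall>z. span {z} \<in> I (\<sigma>\<^sup>2) \<and> span {X z} \<noteq> span {z} \<longrightarrow>
                outer_correspondence \<omega> Q (span {z}) (span {cayley X \<sigma> z})))
     \<and> (\<exists>T. (\<forall>Q \<in> {\<Sigma>, \<Sigma>'}. outer_billiard_map \<omega> Q T) \<and>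
           (\<forall>\<sigma>>0. \<not> is_eigenvalue X (1 / \<sigma>) \<longrightarrow>
             (\<forall>z. span {z} \<in> I (\<sigma>\<^sup>2) \<inter> billiard_domain \<omega> \<Sigma> \<longrightarrow>
                T (span {z}) = span {cayley X \<sigma> z})))"
proof -
  interpret q: symplectic_quadric \<omega> S S' X
    by unfold_locales (use assms in \<open>simp_all add: X_def S'_def\<close>)
  have I: "I = q.I"
    by (simp add: I_def q.I_def fun_eq_iff)
  note dom = q.billiard_domain_eq and cor = q.correspondents_eq
  have eig: "q.p \<sigma> \<noteq> 0" if "0 < \<sigma>" "\<not> is_eigenvalue X (1 / \<sigma>)" for \<sigma>
    using q.not_eigenvalue_iff that by blast
  show ?thesis
    unfolding I \<Sigma>_def \<Sigma>'_def q.d_def[symmetric]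
  proof (intro conjI)
    show "X \<in> symplectic_algebra \<omega>" by (rule q.X_in_symplectic_algebra)
    show "symmetric_form S'" by (rule q.symmetric_S')
    show "bij S'" by (rule q.bij_S')
    show "\<forall>R. dual_map X \<circ> R \<circ> X = S \<longleftrightarrow> R = S'"
      using q.dual_map_conjugate_iff by blast
    show "polar_surface \<omega> (quadric S) = quadric S'" by (rule q.polar_surface_S)
    show "\<forall>\<sigma>>0. \<forall>\<tau>>0. \<sigma> \<noteq> \<tau> \<longrightarrow> q.I (\<sigma>\<^sup>2) \<inter> q.I (\<tau>\<^sup>2) = quadric S \<inter> quadric S'"
      using q.I_Int by blast
    show "\<forall>\<sigma>>0. bij (\<lambda>v. S v + (\<sigma>\<^sup>2 * q.d) *\<^sub>R S' v) \<longleftrightarrow> \<not> is_eigenvalue X (1 / \<sigma>)"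
      using q.bij_pencil_iff q.not_eigenvalue_iff by simp
    show "\<forall>Q\<in>{quadric S, quadric S'}. billiard_domain \<omega> Q =
        (\<Union>\<sigma>\<in>{\<sigma>. 0 < \<sigma> \<and> \<not> is_eigenvalue X (1 / \<sigma>)}. q.I (\<sigma>\<^sup>2)) - quadric S \<inter> quadric S'"
      by (intro ballI) (rule trans[OF dom q.D_eq])
    show "\<forall>Q\<in>{quadric S, quadric S'}. {Z. correspondents \<omega> Q Z \<noteq> {}} \<subseteq> (\<Union>\<sigma>\<in>{0<..}. q.I (\<sigma>\<^sup>2))"
      using q.corr_nonempty_subset by (simp add: cor)
    show "\<forall>Q\<in>{quadric S, quadric S'}. {Z. correspondents \<omega> Q Z \<noteq> {}} - quadric S \<inter> quadric S' =
        {span {z} |z \<sigma>. 0 < \<sigma> \<and> span {z} \<in> q.I (\<sigma>\<^sup>2) \<and> S z + (\<sigma>\<^sup>2 * q.d) *\<^sub>R S' z \<noteq> 0}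
          - quadric S \<inter> quadric S'"
      unfolding q.corr_domain_regular[symmetric] by (simp add: cor)
    show "\<forall>Q\<in>{quadric S, quadric S'}. \<forall>\<sigma>>0. \<forall>Z\<in>q.I (\<sigma>\<^sup>2). correspondents \<omega> Q Z \<subseteq> q.I (\<sigma>\<^sup>2)"
      by (auto simp: cor intro: q.corr_I_invariant)
    show "\<forall>Q\<in>{quadric S, quadric S'}. \<forall>T. outer_billiard_map \<omega> Q T \<longrightarrow>
        (\<forall>\<sigma>>0. T ` (q.I (\<sigma>\<^sup>2) \<inter> billiard_domain \<omega> Q) = q.I (\<sigma>\<^sup>2) \<inter> billiard_domain \<omega> Q)"
      using q.outer_billiard_map_I dom by simp
    show "\<forall>\<sigma>>0. \<not> is_eigenvalue X (1 / \<sigma>) \<longrightarrow>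
        bij (\<lambda>v. v + \<sigma> *\<^sub>R X v) \<and> bij (\<lambda>v. v - \<sigma> *\<^sub>R X v)
        \<and> bij_betw (image (cayley X \<sigma>)) (q.I (\<sigma>\<^sup>2)) (q.I (\<sigma>\<^sup>2))
        \<and> (\<forall>Q\<in>{quadric S, quadric S'}. \<forall>z. span {z} \<in> q.I (\<sigma>\<^sup>2) \<and> span {X z} \<noteq> span {z} \<longrightarrow>
             outer_correspondence \<omega> Q (span {z}) (span {cayley X \<sigma> z}))"
    proof (intro allI impI conjI ballI)
      fix \<sigma> :: real assume \<sigma>: "0 < \<sigma>" "\<not> is_eigenvalue X (1 / \<sigma>)"
      note p = eig[OF \<sigma>]
      show "bij (\<lambda>v. v + \<sigma> *\<^sub>R X v)" using q.bij_add_X[OF p] .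
      show "bij (\<lambda>v. v - \<sigma> *\<^sub>R X v)" using q.bij_add_X[of "- \<sigma>"] p by simp
      show "bij_betw (image (cayley X \<sigma>)) (q.I (\<sigma>\<^sup>2)) (q.I (\<sigma>\<^sup>2))" by (rule q.bij_betw_cayley_I[OF p])
      fix Q z assume Q: "Q \<in> {quadric S, quadric S'}"
        and z: "span {z} \<in> q.I (\<sigma>\<^sup>2) \<and> span {X z} \<noteq> span {z}"
      have "q.corr (span {z}) (span {cayley X \<sigma> z})"
        by (rule q.corr_cayley[OF \<sigma>(1) p conjunct1[OF z] conjunct2[OF z]])
      then show "outer_correspondence \<omega> Q (span {z}) (span {cayley X \<sigma> z})"
        using Q q.corr_S q.corr_S' by auto
    qed
    show "\<exists>T. (\<forall>Q\<in>{quadric S, quadric S'}. outer_billiard_map \<omega> Q T) \<and>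
        (\<forall>\<sigma>>0. \<not> is_eigenvalue X (1 / \<sigma>) \<longrightarrow>
          (\<forall>z. span {z} \<in> q.I (\<sigma>\<^sup>2) \<inter> billiard_domain \<omega> (quadric S) \<longrightarrow>
             T (span {z}) = span {cayley X \<sigma> z}))"
    proof (intro exI[of _ "q.billiard 1"] conjI allI impI)
      show "\<forall>Q\<in>{quadric S, quadric S'}. outer_billiard_map \<omega> Q (q.billiard 1)"
        using q.outer_billiard_map_billiard by blast
      fix \<sigma> :: real and z assume \<sigma>: "0 < \<sigma>" "\<not> is_eigenvalue X (1 / \<sigma>)"
        and z: "span {z} \<in> q.I (\<sigma>\<^sup>2) \<inter> billiard_domain \<omega> (quadric S)"
      show "q.billiard 1 (span {z}) = span {cayley X \<sigma> z}"
        using q.billiard_formula[OF \<sigma>(1) eig[OF \<sigma>]] z dom[of "quadric S"] by simp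
    qed
  qed
qed

end
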